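(* Let $p$ be a prime and let $\mathcal{C}=(V,\mathcal{R})$ be an association scheme. Then $\mathcal{C}$ is a $p$-scheme if and only if each non-reflexive basis digraph of $\mathcal{C}$ is cyclically $p$-partite.
   Context: All sets are finite. A relation on $V$ is a subset $R\subseteq V\times V$; $\Delta(V)=\{(v,v):v\in V\}$; $R^T=\{(u,v):(v,u)\in R\}$. The support $V_R$ of a relation $R$ is the smallest $X\subseteq V$ with $R\subseteq X\times X$. Scheme: let $V$ be a finite nonempty set and $\mathcal{R}$ a partition of $V\times V$ (into nonempty relations) closed under $R\mapsto R^T$. Let $\mathcal{R}^*$ be the set of all unions of elements of $\mathcal{R}$. The pair $\mathcal{C}=(V,\mathcal{R})$ is a scheme (coherent configuration) if $\Delta(V)\in\mathcal{R}^*$ and for all $R,S,T\in\mathcal{R}$ the number $c_{R,S}^T=|\{v\in V:(u,v)\in R,\ (v,w)\in S\}|$ does not depend on the choice of $(u,w)\in T$. The elements of $\mathcal{R}$ are the basis relations. The scheme is homogeneous, also called an association scheme, if $\Delta(V)\in\mathcal{R}$ (no commutativity or symmetry is assumed). A scheme is a $p$-scheme if $|R|$ is a power of $p$ (with $p^0=1$ allowed) for every $R\in\mathcal{R}$. A digraph is a pair $(V,R)$ with $R\subseteq V\times V$; it is reflexive if $\Delta(V)\subseteq R$. The basis digraphs of $\mathcal{C}$ are the digraphs $(V_R,R)$ with $R\in\mathcal{R}$. For an association scheme $V_R=V$ for all $R\in\mathcal{R}$, and the only reflexive basis digraph is $(V,\Delta(V))$. For an integer $p>1$, a digraph is cyclically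 $p$-partite if its vertex set can be partitioned into $p$ nonempty mutually disjoint sets $V_0,\dots,V_{p-1}$ such that whenever $(u,v)$ is an arc with $u\in V_i$, $v\in V_j$, one has $j-i\equiv 1 \pmod p$. *)

theory Defs
  imports "HOL-Library.Disjoint_Sets" "HOL-Number_Theory.Number_Theory"
begin

definition support :: "'v rel \<Rightarrow> 'v set" where
  "support R = (LEAST X. R \<subseteq> X \<times> X)"

lemma support_eq_Field: "support R = Field R"
  unfolding support_def by (rule Least_equality) (auto simp: Field_def)

definition unions_of :: "'a set set \<Rightarrow> 'a set set" where
  "unions_of \<R> = {\<Union>\<S> | \<S>. \<S> \<subseteq> \<R>}"

definition count_between :: "'v set \<Rightarrow> 'v rel \<Rightarrow> 'v rel \<Rightarrow> 'v \<Rightarrow> 'v \<Rightarrow> nat" where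
  "count_between V R S u w = card {v \<in> V. (u, v) \<in> R \<and> (v, w) \<in> S}"

text \<open>Coherent configurations. The last axiom says that the intersection number
  \<open>c_{R,S}^T\<close> is well defined.\<close>

locale scheme =
  fixes V :: "'v set" and \<R> :: "'v rel set"
  assumes finite_points: "finite V"
    and points_nonempty: "V \<noteq> {}"
    and partition: "partition_on (V \<times> V) \<R>"
    and converse_closed: "R \<in> \<R> \<Longrightarrow> R\<inverse> \<in> \<R>"
    and diagonal: "Id_on V \<in> unions_of \<R>"
    and intersection_numbers:
      "\<lbrakk>R \<in> \<R>; S \<in> \<R>; T \<in> \<R>; (u, w) \<in> T; (u', w') \<in> T\<rbrakk>
        \<Longrightarrow> count_between V R S u w = count_between V R S u' w'"

locale association_scheme = scheme +
  assumes homogeneous: "Id_on V \<in> \<R>"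

definition p_scheme :: "nat \<Rightarrow> 'v set \<Rightarrow> 'v rel set \<Rightarrow> bool" where
  "p_scheme p V \<R> \<longleftrightarrow> scheme V \<R> \<and> (\<forall>R\<in>\<R>. \<exists>k. card R = p ^ k)"

text \<open>A digraph is the pair of its vertex set and its arc relation.\<close>

type_synonym 'v digraph = "'v set \<times> 'v rel"

definition reflexive_digraph :: "'v digraph \<Rightarrow> bool" where
  "reflexive_digraph G \<longleftrightarrow> Id_on (fst G) \<subseteq> snd G"

definition basis_digraphs :: "'v rel set \<Rightarrow> 'v digraph set" where
  "basis_digraphs \<R> = {(support R, R) | R. R \<in> \<R>}"

text \<open>Only meant for \<open>p > 1\<close>.\<close>

definition cyclically_partite :: "nat \<Rightarrow> 'v digraph \<Rightarrow> bool" where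
  "cyclically_partite p G \<longleftrightarrow>
    (\<exists>P :: nat \<Rightarrow> 'v set.
      (\<Union>i<p. P i) = fst G \<and>
      (\<forall>i<p. P i \<noteq> {}) \<and>
      disjoint_family_on P {..<p} \<and>
      (\<forall>(u, v) \<in> snd G. \<forall>i<p. \<forall>j<p.
        u \<in> P i \<longrightarrow> v \<in> P j \<longrightarrow> [int j - int i = 1] (mod int p)))"

end

theory Submission
  imports Defs
begin

text \<open>A cyclic \<open>p\<close>-partition of a basis digraph amounts to a colouring \<open>f\<close> of the points by residues
  modulo \<open>p\<close> that increases by one along every arc: every vertex has a successor, so all residues
  occur (\<open>cyclically_partite_iff_colouring\<close>). The theorem thus says that all basis relations have
  \<open>p\<close>-power size exactly if every non-diagonal one has such a colouring. In both directions the
  scheme behaves like a group: a basis relation of valency one is the graph of a permutation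
  (a \<^emph>\<open>thin\<close> relation), and such a permutation of order \<open>p\<close> replaces the central element of order
  \<open>p\<close> in the usual inductions over \<open>p\<close>-groups.

  From a \<open>p\<close>-scheme to colourings (\<open>p_scheme_colouring\<close>). The valencies are powers of \<open>p\<close> and sum up
  to \<open>card V\<close>, so the diagonal cannot be the only relation of valency one, and some thin permutation
  has order \<open>p\<close>. If the given relation is one of its powers, the points on each of its cycles are
  coloured by their position. Otherwise its image in the quotient by the orbits is not diagonal;
  the quotient is again a \<open>p\<close>-scheme, and a colouring of it, which exists by induction, pulls back.

  From colourings to a \<open>p\<close>-scheme. McKay's proof of Cauchy's theorem carries over: for a prime
  \<open>q \<noteq> p\<close> count the closed walks with \<open>q\<close> steps at a point by the sequence of basis relations they
  follow. Rotating the sequence does not change the number, so modulo \<open>q\<close> only constant sequences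
  matter. Along a coloured relation no walk of length \<open>q\<close> is closed, which leaves the single walk along the
  diagonal: \<open>card V ^ (q - 1)\<close> is \<open>1\<close> modulo \<open>q\<close>. So no prime \<open>q \<noteq> p\<close> divides \<open>card V\<close>
  (\<open>card_points_prime_power\<close>). For a single relation \<open>R\<close> with colouring \<open>f\<close>, the walks along \<open>R\<close> of
  length divisible by \<open>p\<close> form an equivalence relation \<open>D\<close>, a union of basis relations, that \<open>f\<close>
  separates from \<open>R\<close>; by induction on the size of an equivalence containing \<open>R\<close>, the basis relations inside
  \<open>D\<close> have \<open>p\<close>-power size (\<open>colourings_imp_prime_power\<close>). As \<open>R\<close> normalizes \<open>D\<close>, taking quotients
  by thin permutations inside \<open>D\<close> until \<open>D\<close> becomes the diagonal shows that the size of \<open>R\<close> is a power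
  of \<open>p\<close> as well (\<open>prime_power_of_normalized_closed\<close>).\<close>

section \<open>Cyclic permutations\<close>

lemma funpow_fixed_coprime:
  fixes \<phi> :: "'a \<Rightarrow> 'a"
  assumes "coprime a b" "(\<phi> ^^ a) x = x" "(\<phi> ^^ b) x = x"
  shows "\<phi> x = x"
proof (cases "b = 1")
  case True
  then show ?thesis using assms by simp
next
  case False
  have mult: "(\<phi> ^^ (m * k)) x = x" if "(\<phi> ^^ m) x = x" for m k
    using that by (induction k) (simp_all add: funpow_add)
  obtain k l where "a * k = b * l + 1"
    using coprime_bezout_strong[OF assms(1) False] by blast
  then have "(\<phi> ^^ (1 + b * l)) x = x"
    using mult[OF assms(2), of k] by simp
  then show ?thesis
    using mult[OF assms(3), of l] by (simp only: funpow_add) simp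
qed

text \<open>The map splits the set into orbits of exactly \<open>m\<close> elements, on each of which \<open>g\<close> is constant.
  With \<open>g = 1\<close> this is Lagrange's theorem for a semiregular permutation; a general \<open>g\<close> is what the
  counting of closed walks needs.\<close>

lemma dvd_sum_free_cyclic:
  fixes g :: "'a \<Rightarrow> nat"
  assumes "finite A" "\<phi> ` A \<subseteq> A" "m > 0"
    and "\<And>x. x \<in> A \<Longrightarrow> (\<phi> ^^ m) x = x"
    and "\<And>x i. x \<in> A \<Longrightarrow> 0 < i \<Longrightarrow> i < m \<Longrightarrow> (\<phi> ^^ i) x \<noteq> x"
    and "\<And>x. x \<in> A \<Longrightarrow> g (\<phi> x) = g x"
  shows "m dvd sum g A"
  using assms
proof (induction "card A" arbitrary: A rule: less_induct)
  case less
  show ?case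
  proof (cases "A = {}")
    case False
    then obtain x where x: "x \<in> A" by blast
    define Orb where "Orb = (\<lambda>i. (\<phi> ^^ i) x) ` {..<m}"
    have inA: "(\<phi> ^^ i) y \<in> A" if "y \<in> A" for i y
      using that less.prems(2) by (induction i) auto
    have inj: "inj_on (\<lambda>i. (\<phi> ^^ i) x) {..<m}"
    proof (rule linorder_inj_onI)
      fix i j assume ij: "i < j" "i \<in> {..<m}" "j \<in> {..<m}"
      have "(\<phi> ^^ (j - i)) ((\<phi> ^^ i) x) = (\<phi> ^^ j) x"
        using ij by (metis comp_apply funpow_add le_add_diff_inverse2 less_imp_le)
      then show "(\<phi> ^^ i) x \<noteq> (\<phi> ^^ j) x"
        using less.prems(5)[OF inA[OF x, of i], of "j - i"] ij
        by (metis diff_le_self lessThan_iff order_le_less_trans zero_less_diff)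
    qed auto
    have sub: "Orb \<subseteq> A" using inA[OF x] by (auto simp: Orb_def)
    have g: "g ((\<phi> ^^ i) x) = g x" for i
      by (induction i) (use less.prems(6) inA[OF x] in auto)
    have sumOrb: "sum g Orb = m * g x"
      unfolding Orb_def by (simp add: sum.reindex[OF inj] g)
    have closed: "\<phi> ` (A - Orb) \<subseteq> A - Orb"
    proof clarify
      fix y assume y: "y \<in> A" "y \<notin> Orb"
      have "\<phi> y \<notin> Orb"
      proof
        assume "\<phi> y \<in> Orb"
        then obtain i where i: "\<phi> y = (\<phi> ^^ i) x" by (auto simp: Orb_def)
        have "y = (\<phi> ^^ (m - 1)) (\<phi> y)"
          using less.prems(4)[OF y(1)] \<open>m > 0\<close>
          by (metis Suc_pred' comp_apply funpow_Suc_right)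
        also have "\<dots> = (\<phi> ^^ (m - 1 + i)) x"
          by (simp add: i funpow_add)
        also have "\<dots> = (\<phi> ^^ ((m - 1 + i) mod m)) x"
          using funpow_mod_eq less.prems(4)[OF x] by metis
        finally show False using y(2) \<open>m > 0\<close> by (auto simp: Orb_def)
      qed
      then show "\<phi> y \<in> A - Orb" using y(1) less.prems(2) by auto
    qed
    have "x \<in> Orb"
      using \<open>m > 0\<close> unfolding Orb_def by (intro image_eqI[of _ _ 0]) auto
    then have "card (A - Orb) < card A"
      using x less.prems(1) by (metis DiffD2 Diff_subset psubsetI psubset_card_mono)
    then have "m dvd sum g (A - Orb)"
      using less.hyps[of "A - Orb"] less.prems closed by auto
    moreover have "sum g A = sum g (A - Orb) + sum g Orb"
      using sub less.prems(1) by (simp add: sum.subset_diff)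
    ultimately show ?thesis by (simp add: sumOrb)
  qed simp
qed

text \<open>Distinct translates are disjoint, so the size of their union is the size of \<open>X\<close> times the number
  of translates, an orbit size of a group of prime order. The exact value, not just divisibility,
  is what lets information travel from a quotient back to the scheme.\<close>

lemma card_cyclic_translates:
  assumes "prime p" "finite X"
    and per: "\<And>x. x \<in> U \<Longrightarrow> (\<phi> ^^ p) x = x" and U: "\<phi> ` U \<subseteq> U" "X \<subseteq> U"
    and block: "\<And>i. (\<phi> ^^ i) ` X = X \<or> (\<phi> ^^ i) ` X \<inter> X = {}"
  shows "card (\<Union>i. (\<phi> ^^ i) ` X) \<in> {card X, p * card X}"
proof -
  have pow: "((`) \<phi> ^^ i) X = (\<phi> ^^ i) ` X" for i
    by (induction i) (auto simp: image_comp)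
  show ?thesis
proof (cases "\<phi> ` X = X")
  case True
  have "((`) \<phi> ^^ i) X = X" for i
    by (induction i) (use True in simp_all)
  then show ?thesis by (simp add: pow)
next
  case False
  have p: "p > 0" using assms(1) prime_gt_0_nat by blast
  have inU: "(\<phi> ^^ i) x \<in> U" if "x \<in> X" for x i
    using that U by (induction i) auto
  have disj0: "(\<phi> ^^ i) ` X \<inter> X = {}" if i: "0 < i" "i < p" for i
  proof (rule ccontr)
    assume "\<not> ?thesis"
    then have "((`) \<phi> ^^ i) X = X" using block pow by metis
    moreover have "((`) \<phi> ^^ p) X = X"
      using per U(2) by (auto simp: pow image_iff subset_iff)
    moreover have "coprime i p"
      using i \<open>prime p\<close> by (metis coprime_commute nat_dvd_not_less prime_imp_coprime)
    ultimately show False using funpow_fixed_coprime False by metis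
  qed
  have inv_pow: "(\<phi> ^^ (p - i)) ((\<phi> ^^ i) x) = x" if "x \<in> U" "i \<le> p" for x i
    using per[OF that(1)] that(2) by (metis comp_apply funpow_add le_add_diff_inverse2)
  have inj: "inj_on (\<phi> ^^ i) X" if "i \<le> p" for i
    by (rule inj_on_inverseI[where g = "\<phi> ^^ (p - i)"]) (use inv_pow that U in auto)
  have disj: "(\<phi> ^^ i) ` X \<inter> (\<phi> ^^ j) ` X = {}" if ij: "i < j" "j < p" for i j
  proof (rule ccontr)
    assume "\<not> ?thesis"
    then obtain x y where xy: "x \<in> X" "y \<in> X" "(\<phi> ^^ i) x = (\<phi> ^^ j) y" by blast
    have "x = (\<phi> ^^ (p - i)) ((\<phi> ^^ i) ((\<phi> ^^ (j - i)) y))"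
      using inv_pow[of x i] xy ij U by (metis comp_apply funpow_add le_add_diff_inverse less_imp_le less_trans subset_iff)
    also have "\<dots> = (\<phi> ^^ (j - i)) y"
      using inv_pow inU[OF xy(2)] ij by simp
    finally show False using disj0[of "j - i"] ij xy by fastforce
  qed
  have "(\<Union>i. (\<phi> ^^ i) ` X) = (\<Union>i\<in>{..<p}. (\<phi> ^^ i) ` X)"
  proof -
    have "(\<phi> ^^ i) ` X = (\<phi> ^^ (i mod p)) ` X" for i
      by (rule image_cong) (use per U(2) in \<open>auto simp: funpow_mod_eq\<close>)
    moreover have "i mod p \<in> {..<p}" for i using p by simp
    ultimately show ?thesis by blast
  qed
  also have "card \<dots> = (\<Sum>i<p. card ((\<phi> ^^ i) ` X))"
  proof (rule card_UN_disjoint)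
    show "\<forall>i\<in>{..<p}. \<forall>j\<in>{..<p}. i \<noteq> j \<longrightarrow> (\<phi> ^^ i) ` X \<inter> (\<phi> ^^ j) ` X = {}"
      using disj by (metis Int_commute lessThan_iff linorder_neqE_nat)
  qed (use \<open>finite X\<close> in auto)
  also have "\<dots> = p * card X" using inj by (simp add: card_image)
  finally show ?thesis by simp
qed
qed

lemma card_uniform_fibres:
  assumes "finite A" "g ` A = B" "\<And>b. b \<in> B \<Longrightarrow> card {a \<in> A. g a = b} = k"
  shows "card A = k * card B"
proof -
  have "card A = (\<Sum>b\<in>B. card {a \<in> A. g a = b})"
    using sum.group[of A B g "\<lambda>_. 1::nat"] assms by auto
  also have "\<dots> = k * card B" using assms by simp
  finally show ?thesis .
qed

section \<open>Unions of basis relations and valencies\<close>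

context scheme
begin

lemma finite_basis: "finite \<R>"
  using finite_elements[OF _ partition] finite_points by simp

lemma basis_subset: "R \<in> \<R> \<Longrightarrow> R \<subseteq> V \<times> V"
  using partition_onD1[OF partition] by blast

lemma basis_nonempty: "R \<in> \<R> \<Longrightarrow> R \<noteq> {}"
  using partition_onD3[OF partition] by blast

lemma basis_eqI: "R \<in> \<R> \<Longrightarrow> S \<in> \<R> \<Longrightarrow> x \<in> R \<Longrightarrow> x \<in> S \<Longrightarrow> R = S"
  using partition_onD2[OF partition] by (auto simp: disjoint_def)

lemma basis_cover:
  assumes "u \<in> V" "v \<in> V"
  obtains R where "R \<in> \<R>" "(u, v) \<in> R"
  using partition_onD1[OF partition] assms by blast

lemma unions_of_iff:
  "X \<in> unions_of \<R> \<longleftrightarrow> X \<subseteq> V \<times> V \<and> (\<forall>T\<in>\<R>. T \<inter> X \<noteq> {} \<longrightarrow> T \<subseteq> X)"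
proof
  assume "X \<in> unions_of \<R>"
  then obtain \<S> where \<S>: "\<S> \<subseteq> \<R>" "X = \<Union>\<S>" by (auto simp: unions_of_def)
  then show "X \<subseteq> V \<times> V \<and> (\<forall>T\<in>\<R>. T \<inter> X \<noteq> {} \<longrightarrow> T \<subseteq> X)"
    using basis_subset basis_eqI by blast
next
  assume X: "X \<subseteq> V \<times> V \<and> (\<forall>T\<in>\<R>. T \<inter> X \<noteq> {} \<longrightarrow> T \<subseteq> X)"
  have "x \<in> \<Union>{T \<in> \<R>. T \<subseteq> X}" if x: "x \<in> X" for x
  proof -
    have "x \<in> \<Union>\<R>" using X x partition_onD1[OF partition] by auto
    then obtain T where T: "T \<in> \<R>" "x \<in> T" by blast
    then have "T \<subseteq> X" using conjunct2[OF X] x by blast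
    then show ?thesis using T by blast
  qed
  then have "X = \<Union>{T \<in> \<R>. T \<subseteq> X}" by (intro equalityI subsetI) auto
  then show "X \<in> unions_of \<R>" unfolding unions_of_def by blast
qed

lemma unionsD: "X \<in> unions_of \<R> \<Longrightarrow> T \<in> \<R> \<Longrightarrow> x \<in> T \<Longrightarrow> x \<in> X \<Longrightarrow> T \<subseteq> X"
  unfolding unions_of_iff by blast

lemma unions_subset: "X \<in> unions_of \<R> \<Longrightarrow> X \<subseteq> V \<times> V"
  unfolding unions_of_iff by blast

lemma finite_unions: "X \<in> unions_of \<R> \<Longrightarrow> finite X"
  using unions_subset finite_points by (metis finite_SigmaI rev_finite_subset)

lemma unionsI:
  assumes "X \<subseteq> V \<times> V" "\<And>T u v. T \<in> \<R> \<Longrightarrow> (u, v) \<in> T \<Longrightarrow> (u, v) \<in> X \<Longrightarrow> T \<subseteq> X"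
  shows "X \<in> unions_of \<R>"
  unfolding unions_of_iff
proof (intro conjI ballI impI assms(1))
  fix T assume T: "T \<in> \<R>" "T \<inter> X \<noteq> {}"
  then obtain u v where "(u, v) \<in> T" "(u, v) \<in> X" by auto
  then show "T \<subseteq> X" using assms(2) T(1) by simp
qed

lemma basis_in_unions:
  assumes "R \<in> \<R>"
  shows "R \<in> unions_of \<R>"
  by (rule unionsI[OF basis_subset[OF assms]]) (metis assms basis_eqI subset_refl)

lemma unions_converse:
  assumes "X \<in> unions_of \<R>"
  shows "X\<inverse> \<in> unions_of \<R>"
proof (rule unionsI)
  show "X\<inverse> \<subseteq> V \<times> V" using unions_subset[OF assms] by auto
  fix T u v assume "T \<in> \<R>" "(u, v) \<in> T" "(u, v) \<in> X\<inverse>"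
  then have "T\<inverse> \<subseteq> X" using unionsD[OF assms converse_closed, of T "(v, u)"] by simp
  then show "T \<subseteq> X\<inverse>" by auto
qed

lemma unions_Union:
  assumes "\<And>i. i \<in> I \<Longrightarrow> X i \<in> unions_of \<R>"
  shows "(\<Union>i\<in>I. X i) \<in> unions_of \<R>"
proof (rule unionsI)
  show "(\<Union>i\<in>I. X i) \<subseteq> V \<times> V" using unions_subset[OF assms] by auto
  fix T u v assume T: "T \<in> \<R>" "(u, v) \<in> T" "(u, v) \<in> (\<Union>i\<in>I. X i)"
  then obtain i where "i \<in> I" "(u, v) \<in> X i" by auto
  moreover from this have "T \<subseteq> X i" using unionsD[OF assms T(1,2)] by simp
  ultimately show "T \<subseteq> (\<Union>i\<in>I. X i)" by auto
qed

lemma count_between_union: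
  assumes X: "X \<in> unions_of \<R>" and Y: "Y \<in> unions_of \<R>"
  shows "count_between V X Y u w =
    (\<Sum>(R, S) \<in> {R \<in> \<R>. R \<subseteq> X} \<times> {S \<in> \<R>. S \<subseteq> Y}. count_between V R S u w)"
proof -
  let ?I = "{R \<in> \<R>. R \<subseteq> X} \<times> {S \<in> \<R>. S \<subseteq> Y}"
  have "{v \<in> V. (u, v) \<in> X \<and> (v, w) \<in> Y} =
      (\<Union>i\<in>?I. {v \<in> V. (u, v) \<in> fst i \<and> (v, w) \<in> snd i})" (is "?A = ?B")
  proof
    show "?A \<subseteq> ?B"
    proof
      fix v assume v: "v \<in> ?A"
      then have "(u, v) \<in> V \<times> V" "(v, w) \<in> V \<times> V" using X Y unions_subset by blast+
      then obtain R S where "R \<in> \<R>" "(u, v) \<in> R" "S \<in> \<R>" "(v, w) \<in> S"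
        by (metis basis_cover mem_Sigma_iff)
      moreover from this have "R \<subseteq> X" "S \<subseteq> Y" using v unionsD[OF X] unionsD[OF Y] by blast+
      ultimately show "v \<in> ?B" using v by (intro UN_I[of "(R, S)"]) auto
    qed
  qed auto
  moreover have "card ?B = (\<Sum>i\<in>?I. card {v \<in> V. (u, v) \<in> fst i \<and> (v, w) \<in> snd i})"
  proof (rule card_UN_disjoint)
    show "\<forall>i\<in>?I. \<forall>j\<in>?I. i \<noteq> j \<longrightarrow>
        {v \<in> V. (u, v) \<in> fst i \<and> (v, w) \<in> snd i} \<inter> {v \<in> V. (u, v) \<in> fst j \<and> (v, w) \<in> snd j} = {}"
      by (auto simp: prod_eq_iff dest: basis_eqI)
  qed (use finite_basis finite_points in auto)
  ultimately show ?thesis by (simp add: count_between_def split_beta)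
qed

text \<open>Summing over the basis relations inside \<open>X\<close> and \<open>Y\<close> extends the axiom to unions. This makes unions
  closed under composition and, applied to \<open>X\<close> and its converse on the diagonal, makes the
  out-degree constant.\<close>

lemma count_between_const:
  assumes "X \<in> unions_of \<R>" "Y \<in> unions_of \<R>" "T \<in> \<R>" "(u, w) \<in> T" "(u', w') \<in> T"
  shows "count_between V X Y u w = count_between V X Y u' w'"
  unfolding count_between_union[OF assms(1,2)]
  by (rule sum.cong) (use intersection_numbers[OF _ _ assms(3-5)] in auto)

lemma unions_relcomp:
  assumes X: "X \<in> unions_of \<R>" and Y: "Y \<in> unions_of \<R>"
  shows "X O Y \<in> unions_of \<R>"
proof (rule unionsI)
  show "X O Y \<subseteq> V \<times> V" using unions_subset[OF X] unions_subset[OF Y] by auto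
  fix T u w assume T: "T \<in> \<R>" and uw: "(u, w) \<in> T" "(u, w) \<in> X O Y"
  have pos: "(a, b) \<in> X O Y \<longleftrightarrow> count_between V X Y a b > 0" for a b
    using unions_subset[OF X] finite_points by (auto simp: count_between_def card_gt_0_iff)
  show "T \<subseteq> X O Y"
  proof (rule subrelI)
    fix a b assume "(a, b) \<in> T"
    then show "(a, b) \<in> X O Y"
      using count_between_const[OF X Y T uw(1)] uw(2) by (simp only: pos)
  qed
qed

end

context association_scheme
begin

lemma diagonal_unions: "Id_on V \<in> unions_of \<R>"
  by (rule basis_in_unions) (rule homogeneous)

lemma basis_fixed_point: "R \<in> \<R> \<Longrightarrow> (v, v) \<in> R \<Longrightarrow> R = Id_on V"
  using homogeneous basis_eqI basis_subset by (metis Id_onI SigmaD1 subsetD)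

lemma card_eq_valency:
  assumes X: "X \<in> unions_of \<R>" and u: "u \<in> V"
  shows "card X = card V * card (X `` {u})"
proof -
  have val: "card (X `` {a}) = count_between V X (X\<inverse>) a a" for a
    using unions_subset[OF X] unfolding count_between_def by (intro arg_cong[of _ _ card]) auto
  have const: "card (X `` {a}) = card (X `` {u})" if "a \<in> V" for a
    unfolding val
    by (rule count_between_const[OF X unions_converse[OF X] homogeneous]) (use that u in auto)
  have "card X = card (SIGMA a:V. X `` {a})"
    using unions_subset[OF X] by (intro arg_cong[of _ _ card]) auto
  also have "\<dots> = (\<Sum>a\<in>V. card (X `` {a}))"
    by (rule card_SigmaI) (use finite_points finite_unions[OF X] in auto)
  also have "\<dots> = card V * card (X `` {u})" by (simp add: const)
  finally show ?thesis .
qed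

lemma successor_exists:
  assumes "X \<in> unions_of \<R>" "X \<noteq> {}" "u \<in> V"
  obtains v where "(u, v) \<in> X"
proof -
  have "card X \<noteq> 0" using assms finite_unions by auto
  then have "X `` {u} \<noteq> {}" using card_eq_valency[OF assms(1,3)] by auto
  then show ?thesis using that by blast
qed

lemma unions_relpow: "X \<in> unions_of \<R> \<Longrightarrow> X ^^ n \<inter> V \<times> V \<in> unions_of \<R>"
proof (induction n)
  case 0
  have "Id \<inter> V \<times> V = Id_on V" by auto
  then show ?case by (simp add: diagonal_unions)
next
  case (Suc n)
  have "X ^^ Suc n \<inter> V \<times> V = (X ^^ n \<inter> V \<times> V) O X"
    using unions_subset[OF Suc.prems] by auto
  then show ?case using Suc unions_relcomp by simp
qed

lemma unions_rtrancl:
  assumes "X \<in> unions_of \<R>"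
  shows "X\<^sup>* \<inter> V \<times> V \<in> unions_of \<R>"
proof -
  have "X\<^sup>* \<inter> V \<times> V = (\<Union>n. X ^^ n \<inter> V \<times> V)" by (auto simp: rtrancl_is_UN_relpow)
  then show ?thesis using unions_Union[of UNIV "\<lambda>n. X ^^ n \<inter> V \<times> V"] unions_relpow[OF assms] by simp
qed

text \<open>On a finite set reachability along a union of basis relations is symmetric: all points reach
  equally many points, so if \<open>u\<close> reaches \<open>v\<close>, then the set reached from \<open>v\<close>, contained in the one
  reached from \<open>u\<close>, equals it and contains \<open>u\<close>.\<close>

lemma equiv_rtrancl:
  assumes X: "X \<in> unions_of \<R>"
  shows "equiv V (X\<^sup>* \<inter> V \<times> V)"
proof (rule equivI)
  let ?E = "X\<^sup>* \<inter> V \<times> V"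
  have E: "?E \<in> unions_of \<R>" by (rule unions_rtrancl[OF X])
  show "sym ?E"
  proof (rule symI)
    fix u v assume uv: "(u, v) \<in> ?E"
    have "card V * card (?E `` {v}) = card V * card (?E `` {u})"
      using card_eq_valency[OF E] uv by (metis IntD2 SigmaD1 SigmaD2)
    then have "card (?E `` {v}) = card (?E `` {u})"
      using finite_points points_nonempty by simp
    moreover have "?E `` {v} \<subseteq> ?E `` {u}" using uv by auto
    ultimately have "?E `` {v} = ?E `` {u}"
      using finite_unions[OF E] by (metis card_subset_eq finite_Image)
    moreover have "u \<in> ?E `` {u}" using uv by auto
    ultimately show "(v, u) \<in> ?E" by blast
  qed
qed (auto simp: refl_on_def trans_def)

end

section \<open>Closed walks and the number of points\<close>

lemma relpow_mult:
  fixes R :: "'a rel"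
  shows "(R ^^ m) ^^ k = R ^^ (m * k)"
proof (induction k)
  case (Suc k)
  have "(R ^^ m) ^^ Suc k = R ^^ (m * k) O R ^^ m" using Suc by (simp only: relpow.simps)
  also have "\<dots> = R ^^ (m * k + m)" by (rule relpow_add[symmetric])
  finally show ?case by (simp add: add.commute)
qed simp

definition cyclic_colouring :: "nat \<Rightarrow> ('v \<Rightarrow> int) \<Rightarrow> 'v rel \<Rightarrow> bool" where
  "cyclic_colouring p f R \<longleftrightarrow> (\<forall>(u, v) \<in> R. [f v = f u + 1] (mod int p))"

lemma cyclic_colouringD: "cyclic_colouring p f R \<Longrightarrow> (u, v) \<in> R \<Longrightarrow> [f v = f u + 1] (mod int p)"
  by (auto simp: cyclic_colouring_def)

lemma cyclic_colouring_relpow: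
  assumes "cyclic_colouring p f R" "(u, v) \<in> R ^^ n"
  shows "[f v = f u + int n] (mod int p)"
  using assms(2)
proof (induction n arbitrary: v)
  case (Suc n)
  then obtain w where w: "(u, w) \<in> R ^^ n" "(w, v) \<in> R" by auto
  have "[f v = f w + 1] (mod int p)" using cyclic_colouringD[OF assms(1) w(2)] .
  also have "[f w + 1 = (f u + int n) + 1] (mod int p)"
    by (intro cong_add Suc.IH w(1)) simp
  finally show ?case by (simp add: ac_simps)
qed simp

text \<open>This is an entry of the product of the adjacency matrices of the relations in the list.\<close>

fun walk_count :: "'v set \<Rightarrow> 'v rel list \<Rightarrow> 'v \<Rightarrow> 'v \<Rightarrow> nat" where
  "walk_count V [] u w = of_bool (u = w)"
| "walk_count V (R # \<tau>) u w = (\<Sum>v | v \<in> V \<and> (u, v) \<in> R. walk_count V \<tau> v w)"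

lemma walk_count_append:
  assumes "finite V" "u \<in> V"
  shows "walk_count V (\<sigma> @ \<tau>) u w = (\<Sum>x\<in>V. walk_count V \<sigma> u x * walk_count V \<tau> x w)"
  using assms(2)
proof (induction \<sigma> arbitrary: u)
  case Nil
  have "(\<Sum>x\<in>V. of_bool (u = x) * walk_count V \<tau> x w) = (\<Sum>x\<in>V. if x = u then walk_count V \<tau> x w else 0)"
    by (rule sum.cong) auto
  then show ?case using Nil assms(1) by simp
next
  case (Cons R \<sigma>)
  have "walk_count V ((R # \<sigma>) @ \<tau>) u w
      = (\<Sum>v | v \<in> V \<and> (u, v) \<in> R. \<Sum>x\<in>V. walk_count V \<sigma> v x * walk_count V \<tau> x w)"
    using Cons by (auto intro: sum.cong)
  also have "\<dots> = (\<Sum>x\<in>V. \<Sum>v | v \<in> V \<and> (u, v) \<in> R. walk_count V \<sigma> v x * walk_count V \<tau> x w)"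
    by (rule sum.swap)
  also have "\<dots> = (\<Sum>x\<in>V. walk_count V (R # \<sigma>) u x * walk_count V \<tau> x w)"
    by (simp add: sum_distrib_right)
  finally show ?case .
qed

text \<open>The cyclic invariance of the trace of a matrix product.\<close>

lemma closed_walks_rotate:
  assumes "finite V"
  shows "(\<Sum>u\<in>V. walk_count V (\<sigma> @ \<tau>) u u) = (\<Sum>u\<in>V. walk_count V (\<tau> @ \<sigma>) u u)"
proof -
  have "(\<Sum>u\<in>V. walk_count V (\<sigma> @ \<tau>) u u)
      = (\<Sum>u\<in>V. \<Sum>x\<in>V. walk_count V \<sigma> u x * walk_count V \<tau> x u)"
    using assms by (intro sum.cong refl walk_count_append)
  also have "\<dots> = (\<Sum>x\<in>V. \<Sum>u\<in>V. walk_count V \<tau> x u * walk_count V \<sigma> u x)"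
    by (subst sum.swap) (simp add: mult.commute)
  also have "\<dots> = (\<Sum>u\<in>V. walk_count V (\<tau> @ \<sigma>) u u)"
    using assms by (intro sum.cong refl walk_count_append[symmetric])
  finally show ?thesis .
qed

lemma walk_count_relpow:
  "walk_count V (replicate n R) u w \<noteq> 0 \<Longrightarrow> (u, w) \<in> R ^^ n"
proof (induction n arbitrary: u)
  case (Suc n)
  then have "(\<Sum>v | v \<in> V \<and> (u, v) \<in> R. walk_count V (replicate n R) v w) \<noteq> 0" by simp
  then obtain v where "v \<in> {v. v \<in> V \<and> (u, v) \<in> R}" "walk_count V (replicate n R) v w \<noteq> 0"
    by (rule sum.not_neutral_contains_not_neutral)
  then have "(u, v) \<in> R" "walk_count V (replicate n R) v w \<noteq> 0" by auto
  then show ?case using Suc.IH by (metis relpow_Suc_I2)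
qed (auto split: if_splits)

context association_scheme
begin

text \<open>The product of adjacency matrices lies in the adjacency algebra. In particular its diagonal is
  constant, which turns the rotation invariance of the trace into one for the closed walks at a single point.\<close>

lemma walk_count_const:
  assumes "set \<tau> \<subseteq> \<R>" "T \<in> \<R>" "(u, w) \<in> T" "(u', w') \<in> T"
  shows "walk_count V \<tau> u w = walk_count V \<tau> u' w'"
  using assms
proof (induction \<tau> arbitrary: T u w u' w')
  case Nil
  have "u = w \<longleftrightarrow> u' = w'"
    using basis_fixed_point[OF Nil(2)] Nil(3,4) by (metis Id_on_iff)
  then show ?case by simp
next
  case (Cons R \<tau>)
  have R: "R \<in> \<R>" using Cons.prems by simp
  \<comment> \<open>By induction the entries for \<open>\<tau>\<close> depend on the basis relation \<open>S\<close> only; \<open>c S\<close> is that common value.\<close>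
  define c where "c S = (case SOME x. x \<in> S of (a, b) \<Rightarrow> walk_count V \<tau> a b)" for S
  have c: "walk_count V \<tau> a b = c S" if "S \<in> \<R>" "(a, b) \<in> S" for S a b
  proof -
    have "(SOME x. x \<in> S) \<in> S" using that by (metis someI)
    then show ?thesis
      unfolding c_def using Cons.IH[OF _ that(1,2)] Cons.prems(1) by (auto split: prod.split)
  qed
  have "walk_count V (R # \<tau>) a b = (\<Sum>S\<in>\<R>. count_between V R S a b * c S)" if ab: "b \<in> V" for a b
  proof -
    have "{v \<in> V. (a, v) \<in> R} \<subseteq> (\<Union>S\<in>\<R>. {v \<in> V. (a, v) \<in> R \<and> (v, b) \<in> S})"
    proof
      fix v assume v: "v \<in> {v \<in> V. (a, v) \<in> R}"
      then obtain S where "S \<in> \<R>" "(v, b) \<in> S" using basis_cover[of v b] ab by auto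
      then show "v \<in> (\<Union>S\<in>\<R>. {v \<in> V. (a, v) \<in> R \<and> (v, b) \<in> S})" using v by auto
    qed
    then have eq: "{v \<in> V. (a, v) \<in> R} = (\<Union>S\<in>\<R>. {v \<in> V. (a, v) \<in> R \<and> (v, b) \<in> S})"
      by (intro equalityI) auto
    have "walk_count V (R # \<tau>) a b
        = (\<Sum>v\<in>(\<Union>S\<in>\<R>. {v \<in> V. (a, v) \<in> R \<and> (v, b) \<in> S}). walk_count V \<tau> v b)"
      by (simp add: eq)
    also have "\<dots> = (\<Sum>S\<in>\<R>. \<Sum>v\<in>{v \<in> V. (a, v) \<in> R \<and> (v, b) \<in> S}. walk_count V \<tau> v b)"
      by (rule sum.UNION_disjoint) (use finite_basis finite_points in \<open>auto dest: basis_eqI\<close>)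
    also have "\<dots> = (\<Sum>S\<in>\<R>. \<Sum>v\<in>{v \<in> V. (a, v) \<in> R \<and> (v, b) \<in> S}. c S)"
      by (intro sum.cong refl) (use c in auto)
    finally show ?thesis by (simp add: count_between_def)
  qed
  moreover have "w \<in> V" "w' \<in> V" using Cons.prems basis_subset by blast+
  moreover have "count_between V R S u w = count_between V R S u' w'" if "S \<in> \<R>" for S
    using intersection_numbers[OF R that Cons.prems(2-4)] .
  ultimately show ?case by simp
qed

lemma sum_walk_count_Suc:
  assumes "u \<in> V"
  shows "(\<Sum>\<tau> | set \<tau> \<subseteq> \<R> \<and> length \<tau> = Suc n. walk_count V \<tau> u w)
    = (\<Sum>v\<in>V. \<Sum>\<tau> | set \<tau> \<subseteq> \<R> \<and> length \<tau> = n. walk_count V \<tau> v w)"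
proof -
  let ?L = "\<lambda>n. {\<tau>. set \<tau> \<subseteq> \<R> \<and> length \<tau> = n}"
  have succ: "V = (\<Union>R\<in>\<R>. {v \<in> V. (u, v) \<in> R})"
    using assms by (auto elim: basis_cover)
  have "sum (\<lambda>\<tau>. walk_count V \<tau> u w) (?L (Suc n))
      = (\<Sum>(\<tau>, R)\<in>?L n \<times> \<R>. walk_count V (R # \<tau>) u w)"
    unfolding lists_length_Suc_eq by (subst sum.reindex) (auto simp: inj_on_def intro: sum.cong)
  also have "\<dots> = (\<Sum>\<tau>\<in>?L n. \<Sum>R\<in>\<R>. \<Sum>v | v \<in> V \<and> (u, v) \<in> R. walk_count V \<tau> v w)"
    by (simp add: sum.cartesian_product)
  also have "\<dots> = (\<Sum>\<tau>\<in>?L n. \<Sum>v\<in>(\<Union>R\<in>\<R>. {v \<in> V. (u, v) \<in> R}). walk_count V \<tau> v w)"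
    by (intro sum.cong refl sum.UNION_disjoint[symmetric])
      (use finite_basis finite_points in \<open>auto dest: basis_eqI\<close>)
  also have "\<dots> = (\<Sum>v\<in>V. \<Sum>\<tau>\<in>?L n. walk_count V \<tau> v w)"
    by (subst sum.swap) (simp flip: succ)
  finally show ?thesis .
qed

lemma sum_walk_count:
  assumes "u \<in> V" "w \<in> V"
  shows "(\<Sum>\<tau> | set \<tau> \<subseteq> \<R> \<and> length \<tau> = Suc n. walk_count V \<tau> u w) = card V ^ n"
  using assms(1)
proof (induction n arbitrary: u)
  case 0
  have "{\<tau>. set \<tau> \<subseteq> \<R> \<and> length \<tau> = 0} = {[]}" by auto
  then show ?case
    using sum_walk_count_Suc[OF 0, where n = 0 and w = w] assms(2) finite_points by simp
next
  case (Suc n)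
  show ?case
    unfolding sum_walk_count_Suc[OF Suc.prems, where n = "Suc n" and w = w] using Suc.IH by simp
qed

text \<open>McKay's argument. Counting at one fixed point \<open>u\<close>, instead of over all points, gives the exponent
  \<open>q - 1\<close>; counting over all points would only give \<open>card V ^ q = card V\<close> modulo \<open>q\<close>, which always holds.\<close>

lemma prime_not_dvd_card_points:
  assumes "prime p" "prime q" "q \<noteq> p"
    and col: "\<And>R. R \<in> \<R> \<Longrightarrow> R \<noteq> Id_on V \<Longrightarrow> \<exists>f. cyclic_colouring p f R"
  shows "\<not> q dvd card V"
proof
  assume dvd: "q dvd card V"
  obtain u where u: "u \<in> V" using points_nonempty by blast
  have q: "q > 1" using prime_gt_1_nat[OF assms(2)] .
  define L where "L = {\<tau>. set \<tau> \<subseteq> \<R> \<and> length \<tau> = q}"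
  define g where "g \<tau> = walk_count V \<tau> u u" for \<tau>
  have finL: "finite L" unfolding L_def by (rule finite_lists_length_eq[OF finite_basis])
  have gV: "(\<Sum>v\<in>V. walk_count V \<tau> v v) = card V * g \<tau>" if "set \<tau> \<subseteq> \<R>" for \<tau>
  proof -
    have "walk_count V \<tau> v v = g \<tau>" if "v \<in> V" for v
      unfolding g_def
      by (rule walk_count_const[OF \<open>set \<tau> \<subseteq> \<R>\<close> homogeneous]) (use that u in auto)
    then show ?thesis by simp
  qed
  have g_rot: "g (rotate1 \<tau>) = g \<tau>" if "\<tau> \<in> L" for \<tau>
  proof (cases \<tau>)
    case (Cons R \<sigma>)
    have "card V * g (\<sigma> @ [R]) = card V * g ([R] @ \<sigma>)"
      using closed_walks_rotate[OF finite_points, of "[R]" \<sigma>] gV[of "\<sigma> @ [R]"] gV[of "[R] @ \<sigma>"]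
        that Cons by (simp add: L_def)
    then show ?thesis using Cons finite_points points_nonempty by simp
  qed simp
  \<comment> \<open>As \<open>q\<close> is prime, rotation acts without short orbits on the non-constant lists.\<close>
  define N where "N = {\<tau> \<in> L. rotate1 \<tau> \<noteq> \<tau>}"
  have "q dvd sum g N"
  proof (rule dvd_sum_free_cyclic[where \<phi> = rotate1])
    show "rotate1 ` N \<subseteq> N"
      by (auto simp: N_def L_def inj_eq[OF inj_rotate1])
    show per: "(rotate1 ^^ q) \<tau> = \<tau>" if "\<tau> \<in> N" for \<tau>
      using that by (simp add: N_def L_def flip: rotate_def)
    show "(rotate1 ^^ i) \<tau> \<noteq> \<tau>" if "\<tau> \<in> N" "0 < i" "i < q" for \<tau> i
    proof
      assume "(rotate1 ^^ i) \<tau> = \<tau>"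
      moreover have "coprime i q"
        using that(2,3) assms(2) by (metis coprime_commute nat_dvd_not_less prime_imp_coprime)
      ultimately show False
        using funpow_fixed_coprime per[OF that(1)] that(1) by (metis (mono_tags, lifting) N_def mem_Collect_eq)
    qed
  qed (use q finL g_rot N_def in auto)
  moreover have "sum g (L - N) = 1"
  proof -
    have const: "L - N = (\<lambda>R. replicate q R) ` \<R>"
    proof
      show "L - N \<subseteq> (\<lambda>R. replicate q R) ` \<R>"
      proof
        fix \<tau> assume \<tau>: "\<tau> \<in> L - N"
        then have "rotate1 \<tau> = \<tau>" "\<tau> \<noteq> []" using q by (auto simp: N_def L_def)
        then have "card (set \<tau>) = 1" using rotate1_fixpoint_card by blast
        then obtain R where R: "set \<tau> = {R}" by (metis card_1_singletonE)
        then have "\<tau> = replicate (length \<tau>) R" by (intro replicate_eqI) auto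
        then show "\<tau> \<in> (\<lambda>R. replicate q R) ` \<R>" using R \<tau> by (auto simp: L_def)
      qed
    qed (use q in \<open>auto simp: N_def L_def\<close>)
    have zero: "g (replicate q R) = 0" if R: "R \<in> \<R>" "R \<noteq> Id_on V" for R
    proof (rule ccontr)
      assume "g (replicate q R) \<noteq> 0"
      then have walk: "(u, u) \<in> R ^^ q" unfolding g_def by (rule walk_count_relpow)
      obtain f where f: "cyclic_colouring p f R" using col R by blast
      have "[f u = f u + int q] (mod int p)" by (rule cyclic_colouring_relpow[OF f walk])
      then have "int p dvd int q" by (simp add: cong_iff_dvd_diff)
      then show False using assms(1-3) primes_dvd_imp_eq by (metis of_nat_dvd_iff)
    qed
    have one: "walk_count V (replicate n (Id_on V)) u u = 1" for n
    proof (induction n)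
      case (Suc n)
      have "{v \<in> V. (u, v) \<in> Id_on V} = {u}" using u by auto
      then show ?case using Suc by simp
    qed simp
    have "sum g (L - N) = (\<Sum>R\<in>\<R>. g (replicate q R))"
      unfolding const by (subst sum.reindex) (use q in \<open>auto simp: inj_on_def\<close>)
    also have "\<dots> = (\<Sum>R\<in>{Id_on V}. g (replicate q R))"
      by (rule sum.mono_neutral_right) (use homogeneous zero finite_basis in auto)
    also have "\<dots> = 1" by (simp add: g_def one)
    finally show ?thesis .
  qed
  moreover have "sum g L = sum g N + sum g (L - N)"
    using sum.subset_diff[of N L g] finL by (simp add: N_def)
  moreover have "sum g L = card V ^ (q - 1)"
    using sum_walk_count[OF u u, of "q - 1"] q by (simp add: L_def g_def)
  moreover have "q dvd card V ^ (q - 1)"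
    using dvd q by (metis dvd_power dvd_trans zero_less_diff)
  ultimately have "q dvd 1" by (metis dvd_add_right_iff)
  then show False using q by simp
qed

lemma card_points_prime_power:
  assumes "prime p"
    and "\<And>R. R \<in> \<R> \<Longrightarrow> R \<noteq> Id_on V \<Longrightarrow> \<exists>f. cyclic_colouring p f R"
  shows "\<exists>n. card V = p ^ n"
proof -
  have "card V \<noteq> 0" using finite_points points_nonempty by simp
  then obtain m where m: "card V = p ^ multiplicity p (card V) * m" "\<not> p dvd m"
    using multiplicity_decompose'[of "card V" p] assms(1) by (metis not_prime_unit)
  have "m = 1"
  proof (rule ccontr)
    assume "m \<noteq> 1"
    then obtain q where q: "prime q" "q dvd m" using prime_factor_nat by blast
    then have "q dvd card V" by (subst m(1)) simp
    moreover have "q \<noteq> p" using q(2) m(2) by blast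
    ultimately show False using prime_not_dvd_card_points[OF assms(1) q(1)] assms(2) by blast
  qed
  then show ?thesis using m(1) by auto
qed

end

section \<open>Quotients\<close>

text \<open>A quotient is given by a map \<open>\<pi>\<close> whose kernel is a union of basis relations, and not by classes as
  points: an endomap \<open>\<pi>\<close> then keeps the type of points, as inductions on the number of points require.\<close>

locale scheme_quotient = association_scheme V \<R>
  for V :: "'v set" and \<R> :: "'v rel set" +
  fixes \<pi> :: "'v \<Rightarrow> 'w"
  assumes kernel_union: "{(u, v). u \<in> V \<and> v \<in> V \<and> \<pi> u = \<pi> v} \<in> unions_of \<R>"
begin

definition kernel :: "'v rel" where
  "kernel = {(u, v). u \<in> V \<and> v \<in> V \<and> \<pi> u = \<pi> v}"

definition img :: "'v rel \<Rightarrow> 'w rel" where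
  "img X = map_prod \<pi> \<pi> ` X"

definition saturation :: "'v rel \<Rightarrow> 'v rel" where
  "saturation X = {(u, v). u \<in> V \<and> v \<in> V \<and> (\<pi> u, \<pi> v) \<in> img X}"

lemma kernel_in_unions: "kernel \<in> unions_of \<R>"
  unfolding kernel_def by (rule kernel_union)

lemma imgI: "(u, v) \<in> X \<Longrightarrow> (\<pi> u, \<pi> v) \<in> img X"
  unfolding img_def by force

lemma imgE:
  assumes "x \<in> img X"
  obtains u v where "(u, v) \<in> X" "x = (\<pi> u, \<pi> v)"
  using assms unfolding img_def by auto

lemma saturation_eq:
  assumes "X \<subseteq> V \<times> V"
  shows "saturation X = kernel O X O kernel"
proof
  show "saturation X \<subseteq> kernel O X O kernel"
  proof
    fix x assume "x \<in> saturation X"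
    then obtain u v where x: "x = (u, v)" "u \<in> V" "v \<in> V" "(\<pi> u, \<pi> v) \<in> img X"
      by (auto simp: saturation_def)
    then obtain a b where ab: "(a, b) \<in> X" "\<pi> u = \<pi> a" "\<pi> v = \<pi> b" by (auto elim: imgE)
    then have "(u, a) \<in> kernel" "(b, v) \<in> kernel" using x assms by (auto simp: kernel_def)
    then show "x \<in> kernel O X O kernel" using ab x by blast
  qed
  show "kernel O X O kernel \<subseteq> saturation X"
    by (auto simp: kernel_def saturation_def dest: imgI)
qed

lemma saturation_in_unions: "X \<in> unions_of \<R> \<Longrightarrow> saturation X \<in> unions_of \<R>"
  using saturation_eq[OF unions_subset] unions_relcomp kernel_in_unions by simp

lemma img_basis_eqI:
  assumes "R \<in> \<R>" "S \<in> \<R>" "x \<in> img R" "x \<in> img S"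
  shows "img R = img S"
proof -
  have "img B \<subseteq> img A" if AB: "A \<in> \<R>" "B \<in> \<R>" "x \<in> img A" "x \<in> img B" for A B
  proof -
    obtain c d where cd: "(c, d) \<in> B" "x = (\<pi> c, \<pi> d)" using AB(4) by (rule imgE)
    then have "(c, d) \<in> saturation A"
      using AB basis_subset by (auto simp: saturation_def)
    then have "B \<subseteq> saturation A"
      using unionsD[OF saturation_in_unions[OF basis_in_unions] AB(2)] AB(1) cd(1) by simp
    then show ?thesis by (auto simp: saturation_def elim!: imgE)
  qed
  then show ?thesis using assms by (intro equalityI)
qed

definition fibre_size :: nat where
  "fibre_size = card (kernel `` {SOME v. v \<in> V})"

lemma card_fibre:
  assumes "u \<in> V"
  shows "card {v \<in> V. \<pi> v = \<pi> u} = fibre_size"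
proof -
  have "(SOME v. v \<in> V) \<in> V" using assms by (rule someI)
  then have "card V * card (kernel `` {u}) = card V * fibre_size"
    unfolding fibre_size_def using card_eq_valency[OF kernel_in_unions] assms by metis
  moreover have "kernel `` {u} = {v \<in> V. \<pi> v = \<pi> u}" using assms by (auto simp: kernel_def)
  ultimately show ?thesis using finite_points points_nonempty by simp
qed

lemma fibre_size_pos: "fibre_size > 0"
proof -
  obtain u where "u \<in> V" using points_nonempty by blast
  then have "u \<in> {v \<in> V. \<pi> v = \<pi> u}" by simp
  then show ?thesis using card_fibre[OF \<open>u \<in> V\<close>] finite_points by (metis (no_types, lifting) card_gt_0_iff empty_iff finite_Collect_conjI finite_subset mem_Collect_eq subsetI)
qed

lemma card_points_quotient: "card V = fibre_size * card (\<pi> ` V)"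
  by (rule card_uniform_fibres[where g = \<pi>]) (use finite_points card_fibre in auto)

lemma card_saturation:
  assumes "X \<subseteq> V \<times> V"
  shows "card (saturation X) = fibre_size\<^sup>2 * card (img X)"
proof (rule card_uniform_fibres[where g = "map_prod \<pi> \<pi>"])
  have "saturation X \<subseteq> V \<times> V" by (auto simp: saturation_def)
  then show "finite (saturation X)" using finite_points by (metis finite_SigmaI finite_subset)
  show "map_prod \<pi> \<pi> ` saturation X = img X"
  proof
    show "img X \<subseteq> map_prod \<pi> \<pi> ` saturation X"
      unfolding img_def using assms by (intro image_mono) (auto simp: saturation_def intro: imgI)
  qed (auto simp: saturation_def)
  fix b assume b: "b \<in> img X"
  then obtain u v where uv: "(u, v) \<in> X" "b = (\<pi> u, \<pi> v)" by (rule imgE)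
  then have V: "u \<in> V" "v \<in> V" using assms by auto
  have "{a \<in> saturation X. map_prod \<pi> \<pi> a = b} = {x \<in> V. \<pi> x = \<pi> u} \<times> {x \<in> V. \<pi> x = \<pi> v}"
    using b uv by (auto simp: saturation_def)
  then show "card {a \<in> saturation X. map_prod \<pi> \<pi> a = b} = fibre_size\<^sup>2"
    using V by (simp add: card_cartesian_product card_fibre power2_eq_square)
qed

lemma count_between_quotient:
  assumes "u \<in> V" "w \<in> V"
  shows "count_between V (saturation X) (saturation Y) u w
    = fibre_size * count_between (\<pi> ` V) (img X) (img Y) (\<pi> u) (\<pi> w)"
  unfolding count_between_def
proof (rule card_uniform_fibres[where g = \<pi>])
  fix b assume "b \<in> {v \<in> \<pi> ` V. (\<pi> u, v) \<in> img X \<and> (v, \<pi> w) \<in> img Y}"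
  then obtain v where v: "v \<in> V" "b = \<pi> v" "(\<pi> u, \<pi> v) \<in> img X" "(\<pi> v, \<pi> w) \<in> img Y" by auto
  then have "{a \<in> {v \<in> V. (u, v) \<in> saturation X \<and> (v, w) \<in> saturation Y}. \<pi> a = b} = {a \<in> V. \<pi> a = \<pi> v}"
    using assms by (auto simp: saturation_def)
  then show "card {a \<in> {v \<in> V. (u, v) \<in> saturation X \<and> (v, w) \<in> saturation Y}. \<pi> a = b} = fibre_size"
    using card_fibre[OF v(1)] by simp
qed (use finite_points assms in \<open>auto simp: saturation_def\<close>)

text \<open>By \<open>count_between_quotient\<close> an intersection number of the quotient is, up to the factor
  \<open>fibre_size\<close>, one of the unions \<open>saturation R\<close> and \<open>saturation S\<close> in the given scheme, and those are
  constant on every basis relation.\<close>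

theorem quotient_scheme: "association_scheme (\<pi> ` V) (img ` \<R>)"
proof
  show "finite (\<pi> ` V)" "\<pi> ` V \<noteq> {}" using finite_points points_nonempty by auto
  show diag: "Id_on (\<pi> ` V) \<in> img ` \<R>"
  proof -
    have "Id_on (\<pi> ` V) = img (Id_on V)" by (auto simp: img_def image_iff Bex_def)
    then show ?thesis using homogeneous by blast
  qed
  then show "Id_on (\<pi> ` V) \<in> unions_of (img ` \<R>)"
    unfolding unions_of_def by (intro CollectI exI[of _ "{Id_on (\<pi> ` V)}"]) auto
  show "partition_on (\<pi> ` V \<times> \<pi> ` V) (img ` \<R>)"
  proof (rule partition_onI)
    show "\<Union> (img ` \<R>) = \<pi> ` V \<times> \<pi> ` V"
    proof
      show "\<Union> (img ` \<R>) \<subseteq> \<pi> ` V \<times> \<pi> ` V"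
        using basis_subset by (auto elim!: imgE)
      show "\<pi> ` V \<times> \<pi> ` V \<subseteq> \<Union> (img ` \<R>)"
      proof clarify
        fix u v assume "u \<in> V" "v \<in> V"
        then obtain R where "R \<in> \<R>" "(u, v) \<in> R" by (rule basis_cover)
        then show "(\<pi> u, \<pi> v) \<in> \<Union> (img ` \<R>)" by (auto intro: imgI)
      qed
    qed
    show "disjnt A B" if "A \<in> img ` \<R>" "B \<in> img ` \<R>" "A \<noteq> B" for A B
      using that img_basis_eqI unfolding disjnt_iff by blast
    show "{} \<notin> img ` \<R>" using basis_nonempty by (auto simp: img_def)
  qed
  show "A\<inverse> \<in> img ` \<R>" if A: "A \<in> img ` \<R>" for A
  proof -
    obtain R where R: "R \<in> \<R>" "A = img R" using A by blast
    have "A\<inverse> = img (R\<inverse>)" unfolding R(2) by (auto simp: img_def image_iff Bex_def)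
    then show ?thesis using converse_closed[OF R(1)] by blast
  qed
  fix A B C a c a' c'
  assume "A \<in> img ` \<R>" "B \<in> img ` \<R>" "C \<in> img ` \<R>" and ac: "(a, c) \<in> C" "(a', c') \<in> C"
  then obtain R S T where RST: "R \<in> \<R>" "A = img R" "S \<in> \<R>" "B = img S" "T \<in> \<R>" "C = img T" by blast
  obtain u w where uw: "(u, w) \<in> T" "a = \<pi> u" "c = \<pi> w" using ac(1) RST(6) by (auto elim: imgE)
  obtain u' w' where uw': "(u', w') \<in> T" "a' = \<pi> u'" "c' = \<pi> w'" using ac(2) RST(6) by (auto elim: imgE)
  have V: "u \<in> V" "w \<in> V" "u' \<in> V" "w' \<in> V" using uw(1) uw'(1) basis_subset[OF RST(5)] by auto
  have "count_between V (saturation R) (saturation S) u w = count_between V (saturation R) (saturation S) u' w'"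
    by (rule count_between_const[OF saturation_in_unions saturation_in_unions RST(5) uw(1) uw'(1)])
      (use RST basis_in_unions in auto)
  then show "count_between (\<pi> ` V) A B a c = count_between (\<pi> ` V) A B a' c'"
    using fibre_size_pos unfolding count_between_quotient[OF V(1,2)] count_between_quotient[OF V(3,4)]
    by (simp add: RST uw uw')
qed

lemma img_unions:
  assumes "X \<in> unions_of \<R>"
  shows "img X \<in> unions_of (img ` \<R>)"
proof -
  obtain \<S> where "\<S> \<subseteq> \<R>" "X = \<Union>\<S>" using assms by (auto simp: unions_of_def)
  then have "img X = \<Union>(img ` \<S>)" "img ` \<S> \<subseteq> img ` \<R>" by (auto simp: img_def)
  then show ?thesis unfolding unions_of_def by blast
qed

end

section \<open>Thin relations\<close>

definition graph_on :: "'v set \<Rightarrow> ('v \<Rightarrow> 'v) \<Rightarrow> 'v rel" where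
  "graph_on V s = (\<lambda>u. (u, s u)) ` V"

lemma graph_on_iff [simp]: "(u, v) \<in> graph_on V s \<longleftrightarrow> u \<in> V \<and> v = s u"
  by (auto simp: graph_on_def)

context association_scheme
begin

lemma thin_closed: "graph_on V s \<in> \<R> \<Longrightarrow> u \<in> V \<Longrightarrow> s u \<in> V"
  using basis_subset[of "graph_on V s"] by (auto simp: graph_on_def)

text \<open>A thin relation acts invertibly on the basis relations: the composite is a union of basis relations,
  and shifting any member \<open>T\<close> of that union back gives a union that meets, hence contains, \<open>R\<close>.\<close>

lemma shift_left:
  assumes s: "graph_on V s \<in> \<R>" and R: "R \<in> \<R>"
  shows "map_prod s id ` R \<in> \<R>"
proof -
  let ?G = "graph_on V s"
  have RV: "R \<subseteq> V \<times> V" using basis_subset[OF R] .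
  have eq: "map_prod s id ` R = ?G\<inverse> O R" using RV by force
  have un: "?G\<inverse> O R \<in> unions_of \<R>"
    by (intro unions_relcomp basis_in_unions converse_closed s R)
  obtain u v where uv: "(u, v) \<in> R" using basis_nonempty[OF R] by auto
  then obtain T where T: "T \<in> \<R>" "(s u, v) \<in> T"
    using basis_cover[of "s u" v] thin_closed[OF s] RV by auto
  have "(s u, v) \<in> ?G\<inverse> O R" using uv RV by (intro relcompI[of "s u" u]) auto
  then have "T \<subseteq> ?G\<inverse> O R" using unionsD[OF un] T by blast
  moreover have "R \<subseteq> ?G O T"
  proof (rule unionsD[OF _ R uv])
    show "?G O T \<in> unions_of \<R>" by (intro unions_relcomp basis_in_unions s T)
    show "(u, v) \<in> ?G O T" using uv RV T by (intro relcompI[of u "s u"]) auto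
  qed
  then have "map_prod s id ` R \<subseteq> T" by auto
  ultimately show ?thesis using T(1) eq by auto
qed

lemma shift_right:
  assumes s: "graph_on V s \<in> \<R>" and R: "R \<in> \<R>"
  shows "map_prod id s ` R \<in> \<R>"
proof -
  have "map_prod id s ` R = (map_prod s id ` (R\<inverse>))\<inverse>" by force
  then show ?thesis using shift_left[OF s] converse_closed R by metis
qed

lemma thin_funpow:
  assumes "graph_on V s \<in> \<R>"
  shows "graph_on V (s ^^ i) \<in> \<R>"
proof (induction i)
  case 0
  have "graph_on V (s ^^ 0) = Id_on V" by auto
  then show ?case using homogeneous by (simp only:)
next
  case (Suc i)
  have "graph_on V (s ^^ Suc i) = map_prod id s ` graph_on V (s ^^ i)"
    by (auto simp: graph_on_def image_image)
  then show ?case using shift_right[OF assms Suc] by (simp only:)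
qed

lemma thin_fixed_point:
  assumes "graph_on V s \<in> \<R>" "u \<in> V" "s u = u" "v \<in> V"
  shows "s v = v"
proof -
  have "graph_on V s = Id_on V" using basis_fixed_point[OF assms(1), of u] assms by simp
  then show ?thesis using assms(4) by (metis graph_on_iff pair_in_Id_conv Id_on_iff)
qed

lemma closed_class_card_dvd:
  assumes F: "F \<in> unions_of \<R>" and "equiv V F" "u \<in> V"
  shows "card (F `` {u}) dvd card V"
proof -
  have "card V = card (F `` {u}) * card (V // F)"
  proof (rule card_uniform_fibres[where g = "\<lambda>a. F `` {a}"])
    show "(\<lambda>a. F `` {a}) ` V = V // F" by (auto simp: quotient_def)
    fix b assume "b \<in> V // F"
    then obtain a where a: "a \<in> V" "b = F `` {a}" by (auto simp: quotient_def)
    then have "{c \<in> V. F `` {c} = b} = F `` {a}"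
      using assms(2) eq_equiv_class_iff[OF assms(2)] equiv_class_eq_iff[OF assms(2)] by auto
    moreover have "card (F `` {a}) = card (F `` {u})"
      using card_eq_valency[OF F a(1)] card_eq_valency[OF F assms(3)] finite_points points_nonempty
      by simp
    ultimately show "card {c \<in> V. F `` {c} = b} = card (F `` {u})" by simp
  qed (rule finite_points)
  then show ?thesis by simp
qed

text \<open>The valencies in \<open>F\<close> are powers of \<open>p\<close> whose sum, the class size of \<open>F\<close>, is a nontrivial power of
  \<open>p\<close>. The diagonal contributes \<open>1\<close>, so \<open>p\<close> cannot divide all the other valencies. The proof has every term multiplied
  by \<open>card V = p ^ n\<close>.\<close>

lemma exists_thin_relation:
  assumes p: "prime p" and V: "card V = p ^ n"
    and F: "F \<in> unions_of \<R>" "equiv V F" "F \<noteq> Id_on V"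
    and pow: "\<And>S. S \<in> \<R> \<Longrightarrow> S \<subseteq> F \<Longrightarrow> \<exists>k. card S = p ^ k"
  shows "\<exists>S\<in>\<R>. S \<subseteq> F \<and> S \<noteq> Id_on V \<and> card S = card V"
proof (rule ccontr)
  assume no: "\<not> ?thesis"
  have p1: "p > 1" using prime_gt_1_nat[OF p] .
  obtain u where u: "u \<in> V" using points_nonempty by blast
  have IdF: "Id_on V \<subseteq> F" using F(2) by (auto simp: equiv_def refl_on_def)
  have dvd: "p ^ Suc n dvd card S" if S: "S \<in> \<R>" "S \<subseteq> F" "S \<noteq> Id_on V" for S
  proof -
    obtain k where k: "card S = p ^ k" using pow S by blast
    have "card S = p ^ n * card (S `` {u})"
      using card_eq_valency[OF basis_in_unions[OF S(1)] u] V by simp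
    then have "p ^ n dvd p ^ k" using k by simp
    then have "n \<le> k" using p1 by (simp add: power_dvd_imp_le)
    moreover have "k \<noteq> n" using no that S k V by auto
    ultimately have "Suc n \<le> k" by simp
    then show ?thesis unfolding k by (rule le_imp_power_dvd)
  qed
  have "F = \<Union>{S \<in> \<R>. S \<subseteq> F}"
  proof -
    obtain \<S> where "\<S> \<subseteq> \<R>" "F = \<Union>\<S>" using F(1) by (auto simp: unions_of_def)
    then show ?thesis by blast
  qed
  then have "card F = card (\<Union>{S \<in> \<R>. S \<subseteq> F})" by (rule arg_cong)
  also have "\<dots> = (\<Sum>S | S \<in> \<R> \<and> S \<subseteq> F. card S)"
  proof (rule card_Union_disjoint)
    show "pairwise disjnt {S \<in> \<R>. S \<subseteq> F}"
      using basis_eqI by (auto simp: pairwise_def disjnt_iff)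
    show "finite A" if "A \<in> {S \<in> \<R>. S \<subseteq> F}" for A
      using that finite_unions basis_in_unions by blast
  qed
  also have "\<dots> = card (Id_on V) + (\<Sum>S\<in>{S. S \<in> \<R> \<and> S \<subseteq> F} - {Id_on V}. card S)"
    by (rule sum.remove) (use finite_basis homogeneous IdF in auto)
  finally have sum: "card F = card (Id_on V) + (\<Sum>S\<in>{S. S \<in> \<R> \<and> S \<subseteq> F} - {Id_on V}. card S)" .
  have Id: "card (Id_on V) = card V"
    using card_eq_valency[OF diagonal_unions u] u by (simp add: Id_on_def Image_def)
  have cF: "card F = p ^ n * card (F `` {u})" using card_eq_valency[OF F(1) u] V by simp
  obtain a where a: "card (F `` {u}) = p ^ a"
    using closed_class_card_dvd[OF F(1,2) u] V divides_primepow_nat[OF p] by metis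
  have "a \<noteq> 0"
  proof
    assume "a = 0"
    then have "card F = card (Id_on V)" using cF a V Id by simp
    then show False using card_subset_eq[OF finite_unions[OF F(1)] IdF] F(3) by simp
  qed
  then have "p ^ Suc n dvd card F" unfolding cF a by (cases a) auto
  moreover have "p ^ Suc n dvd (\<Sum>S\<in>{S. S \<in> \<R> \<and> S \<subseteq> F} - {Id_on V}. card S)"
    by (rule dvd_sum) (use dvd in auto)
  ultimately have "p ^ Suc n dvd card (Id_on V)" unfolding sum by (simp only: dvd_add_left_iff)
  then have "p ^ Suc n dvd p ^ n" unfolding Id V .
  then show False using p1 power_dvd_imp_le[of p "Suc n" n] by simp
qed

lemma valency_one_graph:
  assumes "S \<in> unions_of \<R>" "card S = card V"
  obtains s where "S = graph_on V s"
proof -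
  have "\<exists>v. S `` {u} = {v}" if "u \<in> V" for u
  proof -
    have "card V \<noteq> 0" using finite_points points_nonempty by simp
    then have "card (S `` {u}) = 1" using card_eq_valency[OF assms(1) that] assms(2) by auto
    then show ?thesis by (metis card_1_singletonE)
  qed
  then obtain s where s: "\<And>u. u \<in> V \<Longrightarrow> S `` {u} = {s u}" by metis
  have "(u, v) \<in> S \<longleftrightarrow> (u, v) \<in> graph_on V s" for u v
    using s[of u] unions_subset[OF assms(1)] by auto
  then have "S = graph_on V s" by auto
  then show ?thesis by (rule that)
qed

text \<open>A power of a thin permutation is thin and is the identity as soon as it has a fixed point. So all cycles have
  the same length, the order \<open>m\<close>, which divides \<open>card V\<close> and is a power of \<open>p\<close>; the \<open>m div p\<close>-th power
  has order \<open>p\<close>.\<close>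

lemma exists_thin_of_prime_order:
  assumes p: "prime p" and V: "card V = p ^ n"
    and F: "F \<in> unions_of \<R>" "equiv V F" "F \<noteq> Id_on V"
    and pow: "\<And>S. S \<in> \<R> \<Longrightarrow> S \<subseteq> F \<Longrightarrow> \<exists>k. card S = p ^ k"
  obtains t where "graph_on V t \<in> \<R>" "graph_on V t \<subseteq> F"
    "\<And>u. u \<in> V \<Longrightarrow> t u \<noteq> u" "\<And>u. u \<in> V \<Longrightarrow> (t ^^ p) u = u"
proof -
  obtain S where S: "S \<in> \<R>" "S \<subseteq> F" "S \<noteq> Id_on V" "card S = card V"
    using exists_thin_relation[OF assms] by metis
  obtain s where s: "S = graph_on V s" by (rule valency_one_graph[OF basis_in_unions[OF S(1)] S(4)])
  have G: "graph_on V (s ^^ i) \<in> \<R>" for i using thin_funpow S(1) s by simp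
  have inV: "(s ^^ i) u \<in> V" if "u \<in> V" for i u using thin_closed[OF G that] .
  obtain u where u: "u \<in> V" using points_nonempty by blast
  \<comment> \<open>The iterates of \<open>u\<close> repeat; a repetition is a fixed point of a power, which is then the identity.\<close>
  have "\<exists>m>0. \<forall>v\<in>V. (s ^^ m) v = v"
  proof -
    have "range (\<lambda>i. (s ^^ i) u) \<subseteq> V" using inV[OF u] by auto
    then have "\<not> inj (\<lambda>i. (s ^^ i) u)"
      using finite_points by (meson finite_imageD finite_subset infinite_UNIV_nat)
    then obtain i j where ij: "i < j" "(s ^^ i) u = (s ^^ j) u"
      by (metis (mono_tags, lifting) injI linorder_neqE_nat)
    then have "(s ^^ (j - i)) ((s ^^ i) u) = (s ^^ i) u"
      by (metis comp_apply funpow_add le_add_diff_inverse2 less_imp_le)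
    then have "\<forall>v\<in>V. (s ^^ (j - i)) v = v"
      using thin_fixed_point[OF G inV[OF u]] by blast
    then show ?thesis using ij(1) by (intro exI[of _ "j - i"]) simp
  qed
  define m where "m = (LEAST m. m > 0 \<and> (\<forall>v\<in>V. (s ^^ m) v = v))"
  have m: "m > 0" "\<And>v. v \<in> V \<Longrightarrow> (s ^^ m) v = v"
    using LeastI_ex[OF \<open>\<exists>m>0. _\<close>] unfolding m_def by blast+
  have free: "(s ^^ i) v \<noteq> v" if "v \<in> V" "0 < i" "i < m" for v i
    using thin_fixed_point[OF G that(1)] not_less_Least[of i "\<lambda>m. m > 0 \<and> (\<forall>v\<in>V. (s ^^ m) v = v)"] that
    unfolding m_def by blast
  have "m dvd (\<Sum>v\<in>V. 1)"
    by (rule dvd_sum_free_cyclic[where \<phi> = s]) (use finite_points m free inV[of _ 1] in auto)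
  then obtain k where k: "m = p ^ k" using V divides_primepow_nat[OF p] by auto
  have "k \<noteq> 0"
  proof
    assume "k = 0"
    then have "S = Id_on V" using m(2) k s by auto
    then show False using S(3) by simp
  qed
  then have k': "m = p ^ (k - 1) * p" using k by (metis power_minus_mult neq0_conv)
  have p1: "p > 1" using prime_gt_1_nat[OF p] .
  define t where "t = s ^^ (p ^ (k - 1))"
  have Fpow: "(v, (s ^^ i) v) \<in> F" if "v \<in> V" for v i
  proof (induction i)
    case 0
    then show ?case using F(2) that by (auto simp: equiv_def refl_on_def)
  next
    case (Suc i)
    have "((s ^^ i) v, (s ^^ Suc i) v) \<in> F" using S(2) inV[OF that] by (auto simp: s)
    then show ?case using F(2) Suc by (meson equiv_def transD)
  qed
  show ?thesis
  proof (rule that)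
    show "graph_on V t \<in> \<R>" unfolding t_def by (rule G)
    show "graph_on V t \<subseteq> F" using Fpow by (auto simp: t_def)
    show "t v \<noteq> v" if "v \<in> V" for v
      unfolding t_def by (rule free[OF that]) (use p1 m(1) in \<open>auto simp: k'\<close>)
    show "(t ^^ p) v = v" if "v \<in> V" for v
      using m(2)[OF that] by (simp add: t_def funpow_mult k')
  qed
qed

end

section \<open>Quotients by a thin permutation of prime order\<close>

lemma prime_power_mult_iff:
  fixes p :: nat
  assumes "prime p"
  shows "(\<exists>k. p ^ j * b = p ^ k) \<longleftrightarrow> (\<exists>k. b = p ^ k)"
proof
  assume "\<exists>k. p ^ j * b = p ^ k"
  then obtain k where "p ^ j * b = p ^ k" ..
  then have "b dvd p ^ k" by (metis dvd_triv_right)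
  then show "\<exists>k. b = p ^ k" using divides_primepow_nat[OF assms] by blast
next
  assume "\<exists>k. b = p ^ k"
  then show "\<exists>k. p ^ j * b = p ^ k" by (metis power_add)
qed

lemma funpow_map_prod:
  fixes f :: "'a \<Rightarrow> 'a" and g :: "'b \<Rightarrow> 'b"
  shows "map_prod f g ^^ i = map_prod (f ^^ i) (g ^^ i)"
  by (induction i) (auto simp: fun_eq_iff)

locale thin_of_prime_order = association_scheme V \<R>
  for V :: "'v set" and \<R> :: "'v rel set" +
  fixes p :: nat and s :: "'v \<Rightarrow> 'v"
  assumes prime: "prime p"
    and thin: "graph_on V s \<in> \<R>"
    and free: "u \<in> V \<Longrightarrow> s u \<noteq> u"
    and period: "u \<in> V \<Longrightarrow> (s ^^ p) u = u"
begin

text \<open>All exponents are admitted, which makes transitivity immediate; those below \<open>p\<close> give the same relation.\<close>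

definition orb :: "'v rel" where
  "orb = (\<Union>i. graph_on V (s ^^ i))"

definition rep :: "'v \<Rightarrow> 'v" where
  "rep u = (SOME v. (u, v) \<in> orb)"

lemma orb_iff: "(u, v) \<in> orb \<longleftrightarrow> u \<in> V \<and> (\<exists>i. v = (s ^^ i) u)"
  by (auto simp: orb_def)

lemma funpow_in_points: "u \<in> V \<Longrightarrow> (s ^^ i) u \<in> V"
  using thin_closed[OF thin_funpow[OF thin]] .

lemma orb_in_unions: "orb \<in> unions_of \<R>"
  unfolding orb_def by (intro unions_Union basis_in_unions thin_funpow thin)

lemma funpow_eq_imp_dvd:
  assumes "x \<in> V" "i \<le> j" "(s ^^ i) x = (s ^^ j) x"
  shows "p dvd j - i"
proof (rule ccontr)
  assume "\<not> p dvd j - i"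
  then have "coprime (j - i) p" using prime by (metis coprime_commute prime_imp_coprime)
  moreover have "(s ^^ (j - i)) ((s ^^ i) x) = (s ^^ i) x"
    using assms(2,3) by (metis comp_apply funpow_add le_add_diff_inverse2)
  moreover have "(s ^^ p) ((s ^^ i) x) = (s ^^ i) x"
    by (rule period) (rule funpow_in_points[OF assms(1)])
  ultimately have "s ((s ^^ i) x) = (s ^^ i) x" by (rule funpow_fixed_coprime)
  then show False using free funpow_in_points[OF assms(1)] by blast
qed

lemma funpow_eq_imp_cong:
  assumes "x \<in> V" "(s ^^ i) x = (s ^^ j) x"
  shows "[int i = int j] (mod int p)"
proof (cases "i \<le> j")
  case True
  then have "int p dvd int j - int i"
    using funpow_eq_imp_dvd[OF assms(1) True assms(2)] by (simp flip: of_nat_diff)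
  then show ?thesis by (simp add: cong_iff_dvd_diff dvd_diff_commute)
next
  case False
  then have "int p dvd int i - int j"
    using funpow_eq_imp_dvd[OF assms(1) _ assms(2)[symmetric]] by (simp flip: of_nat_diff)
  then show ?thesis by (simp add: cong_iff_dvd_diff)
qed

lemma orb_equiv: "equiv V orb"
proof (rule equivI)
  show "orb \<subseteq> V \<times> V" by (rule unions_subset[OF orb_in_unions])
  show "refl_on V orb"
    by (rule refl_onI) (auto simp: orb_iff intro: exI[of _ 0])
  show "sym orb"
  proof (rule symI)
    fix u v assume "(u, v) \<in> orb"
    then obtain i where i: "u \<in> V" "v = (s ^^ i) u" by (auto simp: orb_iff)
    have "(s ^^ (p * k)) u = u" for k
      by (induction k) (use period[OF i(1)] in \<open>simp_all add: funpow_add\<close>)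
    moreover have "p * i = (p - 1) * i + i" using prime_gt_0_nat[OF prime] by (simp add: algebra_simps)
    ultimately have "u = (s ^^ ((p - 1) * i)) v" unfolding i(2) by (metis comp_apply funpow_add)
    then show "(v, u) \<in> orb" using i funpow_in_points by (auto simp: orb_iff)
  qed
  show "trans orb"
  proof (rule transI)
    fix u v w assume "(u, v) \<in> orb" "(v, w) \<in> orb"
    then obtain i j where "u \<in> V" "v = (s ^^ i) u" "w = (s ^^ j) v" by (auto simp: orb_iff)
    then show "(u, w) \<in> orb" by (auto simp: orb_iff intro!: exI[of _ "j + i"] simp: funpow_add)
  qed
qed

lemma orb_sym: "(u, v) \<in> orb \<Longrightarrow> (v, u) \<in> orb"
  using orb_equiv by (meson equiv_def symD)

lemma orb_trans: "(u, v) \<in> orb \<Longrightarrow> (v, w) \<in> orb \<Longrightarrow> (u, w) \<in> orb"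
  using orb_equiv by (meson equiv_def transD)

lemma orb_refl: "u \<in> V \<Longrightarrow> (u, u) \<in> orb"
  using orb_equiv by (meson equiv_def refl_onD)

lemma rep_rel: "u \<in> V \<Longrightarrow> (u, rep u) \<in> orb"
  unfolding rep_def using orb_refl by (rule someI)

lemma rep_eq_iff:
  assumes "u \<in> V" "v \<in> V"
  shows "rep u = rep v \<longleftrightarrow> (u, v) \<in> orb"
proof
  assume "rep u = rep v"
  then show "(u, v) \<in> orb" using rep_rel assms orb_sym orb_trans by metis
next
  assume "(u, v) \<in> orb"
  then have "(u, w) \<in> orb \<longleftrightarrow> (v, w) \<in> orb" for w using orb_sym orb_trans by blast
  then show "rep u = rep v" by (simp add: rep_def)
qed

lemma kernel_rep: "{(u, v). u \<in> V \<and> v \<in> V \<and> rep u = rep v} = orb"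
  using rep_eq_iff unions_subset[OF orb_in_unions] by auto

sublocale scheme_quotient V \<R> rep
  by unfold_locales (simp add: kernel_rep orb_in_unions)

lemma kernel_eq_orb: "kernel = orb"
  using kernel_rep by (simp add: kernel_def)

lemma fibre_size_eq: "fibre_size = p"
proof -
  obtain u where u: "u \<in> V" using points_nonempty by blast
  have orbit: "{v \<in> V. rep v = rep u} = (\<Union>i. (s ^^ i) ` {u})"
  proof -
    have "v \<in> V \<and> rep v = rep u \<longleftrightarrow> (\<exists>i. v = (s ^^ i) u)" for v
      using rep_eq_iff[OF u, of v] orb_iff[of u v] u funpow_in_points by metis
    then show ?thesis by auto
  qed
  have "card (\<Union>i. (s ^^ i) ` {u}) \<in> {card {u}, p * card {u}}"
    by (rule card_cyclic_translates[where U = V])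
      (use prime u period thin_closed[OF thin] in auto)
  moreover have "card (\<Union>i. (s ^^ i) ` {u}) \<noteq> 1"
  proof
    assume "card (\<Union>i. (s ^^ i) ` {u}) = 1"
    then obtain x where x: "(\<Union>i. (s ^^ i) ` {u}) = {x}" by (metis card_1_singletonE)
    have "(s ^^ i) u = x" for i using x by auto
    from this[of 0] this[of 1] show False using free[OF u] by simp
  qed
  ultimately show ?thesis using card_fibre[OF u] by (simp add: orbit)
qed

text \<open>The next two lemmas compare \<open>R\<close> with its saturation \<open>orb O R O orb\<close>, one side at a time. Translates of \<open>R\<close> by
  powers of \<open>s\<close> are basis relations, and translates of \<open>R O orb\<close> have the form \<open>T O orb\<close> for a basis relation \<open>T\<close>;
  either way two translates are equal or disjoint, and \<open>card_cyclic_translates\<close> applies.\<close>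

lemma card_orb_right:
  assumes R: "R \<in> \<R>"
  shows "card (R O orb) \<in> {card R, p * card R}"
proof -
  have RV: "R \<subseteq> V \<times> V" by (rule basis_subset[OF R])
  have tr: "(map_prod id s ^^ i) ` R \<in> \<R>" for i
  proof (induction i)
    case (Suc i)
    have "(map_prod id s ^^ Suc i) ` R = map_prod id s ` ((map_prod id s ^^ i) ` R)"
      by (simp add: image_comp)
    then show ?case using shift_right[OF thin Suc] by (simp only:)
  qed (simp add: R)
  have "R O orb = (\<Union>i. (map_prod id s ^^ i) ` R)"
  proof
    show "R O orb \<subseteq> (\<Union>i. (map_prod id s ^^ i) ` R)"
    proof
      fix x assume "x \<in> R O orb"
      then obtain u a i where x: "(u, a) \<in> R" "x = (u, (s ^^ i) a)" by (auto simp: orb_iff)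
      then have "x = (map_prod id s ^^ i) (u, a)" by (simp add: funpow_map_prod)
      then show "x \<in> (\<Union>i. (map_prod id s ^^ i) ` R)" using x(1) by blast
    qed
    show "(\<Union>i. (map_prod id s ^^ i) ` R) \<subseteq> R O orb"
    proof
      fix x assume "x \<in> (\<Union>i. (map_prod id s ^^ i) ` R)"
      then obtain i u a where x: "x = (u, (s ^^ i) a)" "(u, a) \<in> R" by (auto simp: funpow_map_prod)
      then have "(a, (s ^^ i) a) \<in> orb" using RV by (auto simp: orb_iff)
      then show "x \<in> R O orb" using x by blast
    qed
  qed
  moreover have "card (\<Union>i. (map_prod id s ^^ i) ` R) \<in> {card R, p * card R}"
  proof (rule card_cyclic_translates[where U = "V \<times> V"])
    show "(map_prod id s ^^ i) ` R = R \<or> (map_prod id s ^^ i) ` R \<inter> R = {}" for i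
      using basis_eqI[OF tr R] by blast
  qed (use prime finite_unions[OF basis_in_unions[OF R]] RV period thin_closed[OF thin]
      in \<open>auto simp: funpow_map_prod\<close>)
  ultimately show ?thesis by simp
qed

lemma card_orb_left:
  assumes R: "R \<in> \<R>"
  shows "card (orb O (R O orb)) \<in> {card (R O orb), p * card (R O orb)}"
proof -
  have un: "T O orb \<in> unions_of \<R>" if "T \<in> \<R>" for T
    using that by (intro unions_relcomp basis_in_unions orb_in_unions)
  have tr: "\<exists>T\<in>\<R>. (map_prod s id ^^ i) ` (R O orb) = T O orb" for i
  proof (induction i)
    case (Suc i)
    then obtain T where T: "T \<in> \<R>" "(map_prod s id ^^ i) ` (R O orb) = T O orb" by blast
    have "(map_prod s id ^^ Suc i) ` (R O orb) = map_prod s id ` ((map_prod s id ^^ i) ` (R O orb))"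
      by (simp add: image_comp)
    also have "\<dots> = map_prod s id ` T O orb" unfolding T(2) by force
    finally show ?case using shift_left[OF thin T(1)] by blast
  qed (use R in auto)
  have eq: "A O orb = B O orb" if AB: "A \<in> \<R>" "B \<in> \<R>" "A O orb \<inter> B O orb \<noteq> {}" for A B
  proof -
    have half: "B O orb \<subseteq> A O orb" if AB: "A \<in> \<R>" "B \<in> \<R>" "A O orb \<inter> B O orb \<noteq> {}" for A B
    proof -
      obtain u w a b where *: "(u, a) \<in> A" "(a, w) \<in> orb" "(u, b) \<in> B" "(b, w) \<in> orb" using AB(3) by auto
      then have "(u, b) \<in> A O orb" using orb_sym orb_trans by blast
      then have "B \<subseteq> A O orb" using unionsD[OF un[OF AB(1)] AB(2) *(3)] by blast
      then show ?thesis using orb_trans by blast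
    qed
    show ?thesis using half[OF AB] half[OF AB(2,1)] AB(3) by blast
  qed
  have XV: "R O orb \<subseteq> V \<times> V" by (rule unions_subset[OF un[OF R]])
  have "orb O (R O orb) = (\<Union>i. (map_prod s id ^^ i) ` (R O orb))"
  proof
    show "orb O (R O orb) \<subseteq> (\<Union>i. (map_prod s id ^^ i) ` (R O orb))"
    proof
      fix x assume "x \<in> orb O (R O orb)"
      then obtain u a w where x: "x = (u, w)" "(u, a) \<in> orb" "(a, w) \<in> R O orb" by blast
      then obtain i where "u = (s ^^ i) a" using orb_sym orb_iff by blast
      then have "x = (map_prod s id ^^ i) (a, w)" using x by (simp add: funpow_map_prod)
      then show "x \<in> (\<Union>i. (map_prod s id ^^ i) ` (R O orb))" using x(3) by blast
    qed
    show "(\<Union>i. (map_prod s id ^^ i) ` (R O orb)) \<subseteq> orb O (R O orb)"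
    proof
      fix x assume "x \<in> (\<Union>i. (map_prod s id ^^ i) ` (R O orb))"
      then obtain i y where y: "y \<in> R O orb" "x = (map_prod s id ^^ i) y" by blast
      obtain a w where "y = (a, w)" by (cases y)
      then have x: "x = ((s ^^ i) a, w)" "(a, w) \<in> R O orb" using y by (simp_all add: funpow_map_prod)
      have "a \<in> V" using x(2) XV by blast
      then have "(a, (s ^^ i) a) \<in> orb" using orb_iff by blast
      then have "((s ^^ i) a, a) \<in> orb" by (rule orb_sym)
      then show "x \<in> orb O (R O orb)" using x by blast
    qed
  qed
  moreover have "card (\<Union>i. (map_prod s id ^^ i) ` (R O orb)) \<in> {card (R O orb), p * card (R O orb)}"
  proof (rule card_cyclic_translates[where U = "V \<times> V"])
    show "(map_prod s id ^^ i) ` (R O orb) = R O orb \<or> (map_prod s id ^^ i) ` (R O orb) \<inter> R O orb = {}" for i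
      using tr[of i] eq[OF _ R] by metis
  qed (use prime finite_unions[OF un[OF R]] XV period thin_closed[OF thin]
      in \<open>auto simp: funpow_map_prod\<close>)
  ultimately show ?thesis by simp
qed

text \<open>The sizes differ by a power of \<open>p\<close>, since \<open>p\<^sup>2 * card (img R)\<close> is the size of the saturation of \<open>R\<close>.\<close>

lemma card_img_prime_power_iff:
  assumes R: "R \<in> \<R>"
  shows "(\<exists>k. card (img R) = p ^ k) \<longleftrightarrow> (\<exists>k. card R = p ^ k)"
proof -
  have "p\<^sup>2 * card (img R) = card (orb O (R O orb))"
    using card_saturation[OF basis_subset[OF R]] saturation_eq[OF basis_subset[OF R]]
    by (simp add: fibre_size_eq kernel_eq_orb)
  also have "\<exists>j. \<dots> = p ^ j * card R"
  proof -
    obtain i where i: "card (R O orb) = p ^ i * card R"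
      using card_orb_right[OF R] by (metis insertE mult_1 power_0 power_one_right singletonD)
    obtain j where j: "card (orb O (R O orb)) = p ^ j * card (R O orb)"
      using card_orb_left[OF R] by (metis insertE mult_1 power_0 power_one_right singletonD)
    have "card (orb O (R O orb)) = p ^ (j + i) * card R" by (simp add: i j power_add)
    then show ?thesis by blast
  qed
  finally show ?thesis using prime_power_mult_iff[OF prime] by metis
qed

lemma card_quotient_points_less: "card (rep ` V) < card V"
proof -
  have "card (rep ` V) \<noteq> 0" using finite_points points_nonempty by simp
  then show ?thesis using card_points_quotient prime_gt_1_nat[OF prime] by (simp add: fibre_size_eq)
qed

text \<open>Each point is coloured by its position on its cycle, counted from the representative of the cycle.\<close>

lemma thin_colouring: "\<exists>f. cyclic_colouring p f (graph_on V s)"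
proof -
  define f where "f u = (SOME i. (s ^^ i) (rep u) = u)" for u
  have f: "(s ^^ f u) (rep u) = u" if "u \<in> V" for u
  proof -
    have "(rep u, u) \<in> orb" using rep_rel[OF that] by (rule orb_sym)
    then have "\<exists>i. (s ^^ i) (rep u) = u" by (metis orb_iff)
    then show ?thesis unfolding f_def by (rule someI_ex)
  qed
  have "[int (f (s u)) = int (f u) + 1] (mod int p)" if u: "u \<in> V" for u
  proof -
    have su: "s u \<in> V" using thin_closed[OF thin u] .
    have "s u = (s ^^ 1) u" by simp
    then have "(u, s u) \<in> orb" using u orb_iff by blast
    then have "rep (s u) = rep u" using rep_eq_iff u su by metis
    then have "(s ^^ f (s u)) (rep u) = (s ^^ Suc (f u)) (rep u)"
      using f[OF u] f[OF su] by simp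
    moreover have "rep u \<in> V" using rep_rel[OF u] unions_subset[OF orb_in_unions] by blast
    ultimately have "[int (f (s u)) = int (Suc (f u))] (mod int p)"
      by (intro funpow_eq_imp_cong)
    then show ?thesis by (simp add: add.commute)
  qed
  then have "cyclic_colouring p (\<lambda>u. int (f u)) (graph_on V s)"
    by (auto simp: cyclic_colouring_def)
  then show ?thesis by (rule exI[of _ "\<lambda>u. int (f u)"])
qed

end

section \<open>Colourings of p-schemes\<close>

lemma p_scheme_colouring:
  assumes "prime p" "association_scheme V \<R>" "\<And>S. S \<in> \<R> \<Longrightarrow> \<exists>k. card S = p ^ k"
    and "R \<in> \<R>" "R \<noteq> Id_on V"
  shows "\<exists>f. cyclic_colouring p f R"
  using assms
proof (induction "card V" arbitrary: V \<R> R rule: less_induct)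
  case less
  interpret association_scheme V \<R> by (rule less.prems)
  note R = less.prems(4,5)
  obtain u where u: "u \<in> V" using points_nonempty by blast
  have "card (Id_on V) = card V"
    using card_eq_valency[OF diagonal_unions u] u by (simp add: Id_on_def Image_def)
  then obtain n where n: "card V = p ^ n" using less.prems(3)[OF homogeneous] by auto
  have all: "V \<times> V \<in> unions_of \<R>" using basis_subset by (intro unionsI) auto
  have "V \<times> V \<noteq> Id_on V"
  proof
    assume "V \<times> V = Id_on V"
    then have "R \<subseteq> Id_on V" using basis_subset[OF R(1)] by simp
    moreover obtain x where "x \<in> R" using basis_nonempty[OF R(1)] by blast
    ultimately show False using basis_eqI[OF R(1) homogeneous] R(2) by blast
  qed
  moreover have "equiv V (V \<times> V)" by (auto intro!: equivI refl_onI symI transI)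
  ultimately obtain t where t: "graph_on V t \<in> \<R>"
    "\<And>u. u \<in> V \<Longrightarrow> t u \<noteq> u" "\<And>u. u \<in> V \<Longrightarrow> (t ^^ p) u = u"
    using exists_thin_of_prime_order[OF less.prems(1) n all] less.prems(3) by metis
  interpret thin_of_prime_order V \<R> p t
    by unfold_locales (use less.prems(1) t in auto)
  show ?case
  proof (cases "R \<subseteq> orb")
    case True
    obtain a b where ab: "(a, b) \<in> R" using basis_nonempty[OF R(1)] by auto
    then obtain i where "(a, b) \<in> graph_on V (t ^^ i)" using True by (auto simp: orb_def)
    then have Ri: "R = graph_on V (t ^^ i)" using basis_eqI[OF R(1) thin_funpow[OF t(1)] ab] by blast
    interpret R: thin_of_prime_order V \<R> p "t ^^ i"
    proof unfold_locales
      show "prime p" by (rule less.prems)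
      show "graph_on V (t ^^ i) \<in> \<R>" by (rule thin_funpow[OF t(1)])
      show "(t ^^ i) v \<noteq> v" if "v \<in> V" for v
        using basis_fixed_point[OF R(1), of v] R(2) that by (auto simp: Ri)
      show "((t ^^ i) ^^ p) v = v" if "v \<in> V" for v
      proof -
        have "((t ^^ p) ^^ i) v = v" by (induction i) (use t(3)[OF that] in auto)
        then show ?thesis by (simp add: funpow_mult mult.commute)
      qed
    qed
    show ?thesis unfolding Ri by (rule R.thin_colouring)
  next
    case False
    have "img R \<noteq> Id_on (rep ` V)"
    proof
      assume Id: "img R = Id_on (rep ` V)"
      have "R \<subseteq> orb"
      proof (rule subrelI)
        fix a b assume ab: "(a, b) \<in> R"
        then have "rep a = rep b" using imgI[OF ab] Id by auto
        then show "(a, b) \<in> orb" using rep_eq_iff ab basis_subset[OF R(1)] by blast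
      qed
      then show False using False by simp
    qed
    moreover have "\<exists>k. card S = p ^ k" if "S \<in> img ` \<R>" for S
      using that card_img_prime_power_iff less.prems(3) by auto
    ultimately obtain f where f: "cyclic_colouring p f (img R)"
      using less.hyps[OF card_quotient_points_less less.prems(1) quotient_scheme, of "img R"] R(1) by blast
    have "cyclic_colouring p (f \<circ> rep) R"
      using cyclic_colouringD[OF f imgI] by (auto simp: cyclic_colouring_def)
    then show ?thesis by (rule exI[of _ "f \<circ> rep"])
  qed
qed

section \<open>Prime power sizes from colourings\<close>

text \<open>If \<open>F\<close> is the diagonal, the assumption \<open>R O F O R\<inverse> \<subseteq> F\<close> says that every point has at most one
  \<open>R\<close>-predecessor, so \<open>R\<close> has valency one. Otherwise \<open>F\<close> contains a thin permutation of order \<open>p\<close>, and all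
  hypotheses pass to the quotient by its orbits because these lie inside the classes of \<open>F\<close>. The
  form \<open>R O F O R\<inverse>\<close>, rather than \<open>R O R\<inverse>\<close>, is the one that survives taking quotients.\<close>

lemma prime_power_of_normalized_closed:
  assumes "prime p" "association_scheme V \<R>" "card V = p ^ n"
    and "F \<in> unions_of \<R>" "equiv V F" "\<And>S. S \<in> \<R> \<Longrightarrow> S \<subseteq> F \<Longrightarrow> \<exists>k. card S = p ^ k"
    and "R \<in> \<R>" "R O F O R\<inverse> \<subseteq> F"
  shows "\<exists>k. card R = p ^ k"
  using assms
proof (induction "card V" arbitrary: V \<R> n F R rule: less_induct)
  case less
  interpret association_scheme V \<R> by (rule less.prems)
  note p = less.prems(1) and n = less.prems(3) and F = less.prems(4,5)
    and pow = less.prems(6) and R = less.prems(7,8)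
  show ?case
  proof (cases "F = Id_on V")
    case True
    obtain u v where uv: "(u, v) \<in> R" using basis_nonempty[OF R(1)] by auto
    have V: "u \<in> V" "v \<in> V" using uv basis_subset[OF R(1)] by auto
    have "R\<inverse> `` {v} = {u}"
    proof
      show "R\<inverse> `` {v} \<subseteq> {u}"
      proof
        fix w assume "w \<in> R\<inverse> `` {v}"
        then have "(u, w) \<in> R O F O R\<inverse>" using uv V True by blast
        then show "w \<in> {u}" using R(2) True by auto
      qed
    qed (use uv in auto)
    then have "card (R\<inverse>) = card V"
      using card_eq_valency[OF unions_converse[OF basis_in_unions[OF R(1)]] V(2)] by simp
    then show ?thesis using n by (metis card_inverse)
  next
    case False
    obtain t where t: "graph_on V t \<in> \<R>" "graph_on V t \<subseteq> F"
      "\<And>u. u \<in> V \<Longrightarrow> t u \<noteq> u" "\<And>u. u \<in> V \<Longrightarrow> (t ^^ p) u = u"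
      using exists_thin_of_prime_order[OF p n F False pow] by metis
    interpret thin_of_prime_order V \<R> p t
      by unfold_locales (use p t in auto)
    have FV: "F \<subseteq> V \<times> V" by (rule unions_subset[OF F(1)])
    have F_refl: "(a, a) \<in> F" if "a \<in> V" for a using F(2) that by (meson equiv_def refl_onD)
    have F_sym: "(b, a) \<in> F" if "(a, b) \<in> F" for a b using F(2) that by (meson equiv_def symD)
    have F_trans: "(a, c) \<in> F" if "(a, b) \<in> F" "(b, c) \<in> F" for a b c
      using F(2) that by (meson equiv_def transD)
    have orb_F: "(a, b) \<in> F" if ab: "(a, b) \<in> orb" for a b
    proof -
      obtain i where a: "a \<in> V" and b: "b = (t ^^ i) a" using ab by (auto simp: orb_iff)
      have "(a, (t ^^ i) a) \<in> F"
      proof (induction i)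
        case (Suc i)
        have "((t ^^ i) a, (t ^^ Suc i) a) \<in> F" using t(2) funpow_in_points[OF a] by auto
        then show ?case using F_trans Suc by blast
      qed (use F_refl a in simp)
      then show ?thesis by (simp add: b)
    qed
    have rep_F: "(a, b) \<in> F" if "a \<in> V" "b \<in> V" "rep a = rep b" for a b
      using that rep_eq_iff orb_F by blast
    have imgF: "(a, b) \<in> F" if ab: "(rep a, rep b) \<in> img F" "a \<in> V" "b \<in> V" for a b
    proof -
      obtain c d where cd: "(c, d) \<in> F" "rep a = rep c" "rep b = rep d" using ab(1) by (auto elim: imgE)
      then have "c \<in> V" "d \<in> V" using FV by auto
      then have "(a, c) \<in> F" "(d, b) \<in> F" using cd ab rep_F by metis+
      then show ?thesis using cd(1) F_trans by blast
    qed
    have "card (rep ` V) dvd p ^ n" using card_points_quotient n by (metis dvd_triv_right)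
    then obtain m where m: "card (rep ` V) = p ^ m" using divides_primepow_nat[OF p] by blast
    have "\<exists>k. card (img R) = p ^ k"
    proof (rule less.hyps[OF card_quotient_points_less p quotient_scheme m img_unions[OF F(1)]])
      show "equiv (rep ` V) (img F)"
      proof (rule equivI)
        show "img F \<subseteq> rep ` V \<times> rep ` V" using FV by (auto elim!: imgE)
        show "refl_on (rep ` V) (img F)" using F_refl by (auto intro!: refl_onI imgI)
        show "sym (img F)" using F_sym by (auto intro!: symI imgI elim!: imgE)
        show "trans (img F)"
        proof (rule transI)
          fix x y z assume xy: "(x, y) \<in> img F" "(y, z) \<in> img F"
          obtain a b where ab: "(a, b) \<in> F" "x = rep a" "y = rep b" using xy(1) by (auto elim: imgE)
          obtain c d where cd: "(c, d) \<in> F" "y = rep c" "z = rep d" using xy(2) by (auto elim: imgE)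
          have "(b, c) \<in> F" using ab cd FV by (intro rep_F) auto
          then have "(a, d) \<in> F" using ab(1) cd(1) F_trans by blast
          then show "(x, z) \<in> img F" unfolding ab(2) cd(3) by (rule imgI)
        qed
      qed
      show "\<exists>k. card S = p ^ k" if S: "S \<in> img ` \<R>" "S \<subseteq> img F" for S
      proof -
        obtain T where T: "T \<in> \<R>" "S = img T" using S(1) by blast
        have "T \<subseteq> F"
        proof (rule subrelI)
          fix a b assume ab: "(a, b) \<in> T"
          then have "(rep a, rep b) \<in> img F" using S(2) T(2) imgI by blast
          then show "(a, b) \<in> F" using ab basis_subset[OF T(1)] by (intro imgF) auto
        qed
        then show ?thesis using pow[OF T(1)] card_img_prime_power_iff[OF T(1)] T(2) by simp
      qed
      show "img R \<in> img ` \<R>" using R(1) by blast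
      show "img R O img F O (img R)\<inverse> \<subseteq> img F"
      proof (rule subrelI)
        fix x y assume "(x, y) \<in> img R O img F O (img R)\<inverse>"
        then obtain z w where zw: "(x, z) \<in> img R" "(z, w) \<in> img F" "(y, w) \<in> img R" by blast
        obtain a b where ab: "(a, b) \<in> R" "x = rep a" "z = rep b" using zw(1) by (auto elim: imgE)
        obtain c d where cd: "(c, d) \<in> R" "y = rep c" "w = rep d" using zw(3) by (auto elim: imgE)
        have "(b, d) \<in> F" using zw(2) ab cd basis_subset[OF R(1)] by (intro imgF) auto
        then have "(a, c) \<in> F" using ab(1) cd(1) R(2) by blast
        then show "(x, y) \<in> img F" unfolding ab(2) cd(2) by (rule imgI)
      qed
    qed
    then show ?thesis using card_img_prime_power_iff[OF R(1)] by simp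
  qed
qed

context association_scheme
begin

text \<open>Induction on the equivalence \<open>F\<close>. The smaller equivalence is \<open>D\<close>, reachability by \<open>R\<close>-walks of length
  divisible by \<open>p\<close>: the colouring \<open>f\<close> is constant modulo \<open>p\<close> on its classes, so \<open>R\<close> is not inside \<open>D\<close>.\<close>

lemma colourings_imp_prime_power:
  assumes p: "prime p" and col: "\<And>R. R \<in> \<R> \<Longrightarrow> R \<noteq> Id_on V \<Longrightarrow> \<exists>f. cyclic_colouring p f R"
    and "F \<in> unions_of \<R>" "equiv V F" "R \<in> \<R>" "R \<subseteq> F"
  shows "\<exists>k. card R = p ^ k"
  using assms(3-6)
proof (induction "card F" arbitrary: F R rule: less_induct)
  case less
  note F = less.prems(1,2) and R = less.prems(3,4)
  obtain n where n: "card V = p ^ n" using card_points_prime_power[OF p col] by blast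
  obtain u where u: "u \<in> V" using points_nonempty by blast
  have p1: "p > 1" using prime_gt_1_nat[OF p] .
  show ?case
  proof (cases "R = Id_on V")
    case True
    have "card (Id_on V) = card V"
      using card_eq_valency[OF diagonal_unions u] u by (simp add: Id_on_def Image_def)
    then show ?thesis using True n by auto
  next
    case False
    obtain f where f: "cyclic_colouring p f R" using col R(1) False by blast
    have RV: "R \<subseteq> V \<times> V" by (rule basis_subset[OF R(1)])
    have Run: "R \<in> unions_of \<R>" by (rule basis_in_unions[OF R(1)])
    \<comment> \<open>The restrictions to \<open>V\<close> make these unions of basis relations; only reflexive pairs outside \<open>V\<close> are lost.\<close>
    define A where "A = R ^^ p \<inter> V \<times> V"
    define D where "D = A\<^sup>* \<inter> V \<times> V"
    have A: "A \<in> unions_of \<R>" unfolding A_def by (rule unions_relpow[OF Run])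
    have "A = R ^^ p"
    proof -
      obtain m where m: "p = Suc m" using p1 by (cases p) auto
      have "R ^^ Suc m \<subseteq> V \<times> V"
      proof (rule subrelI)
        fix a b assume ab: "(a, b) \<in> R ^^ Suc m"
        obtain c where "(a, c) \<in> R" using relpow_Suc_D2[OF ab] by blast
        moreover obtain d where "(d, b) \<in> R" using ab by auto
        ultimately show "(a, b) \<in> V \<times> V" using RV by auto
      qed
      then show ?thesis by (auto simp: A_def m)
    qed
    then have D_iff: "(a, b) \<in> D \<longleftrightarrow> a \<in> V \<and> b \<in> V \<and> (\<exists>k. (a, b) \<in> R ^^ (p * k))" for a b
      by (auto simp: D_def rtrancl_is_UN_relpow relpow_mult)
    have D: "D \<in> unions_of \<R>" "equiv V D"
      unfolding D_def by (rule unions_rtrancl[OF A], rule equiv_rtrancl[OF A])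
    have pow_F: "(a, b) \<in> F" if "a \<in> V" "(a, b) \<in> R ^^ k" for a b k
      using that(2)
    proof (induction k arbitrary: b)
      case 0
      then show ?case using F(2) that(1) by (auto simp: equiv_def refl_on_def)
    next
      case (Suc k)
      then obtain c where "(a, c) \<in> F" "(c, b) \<in> F" using R(2) by auto
      then show ?case using F(2) by (meson equiv_def transD)
    qed
    have "D \<subseteq> F" using pow_F by (auto simp: D_iff)
    moreover have "D \<noteq> F"
    proof
      assume "D = F"
      obtain a b where ab: "(a, b) \<in> R" using basis_nonempty[OF R(1)] by auto
      then have "(a, b) \<in> D" using R(2) \<open>D = F\<close> by blast
      then obtain k where "(a, b) \<in> R ^^ (p * k)" by (auto simp: D_iff)
      then have "[f b = f a + int (p * k)] (mod int p)" by (rule cyclic_colouring_relpow[OF f])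
      moreover have "[f b = f a + 1] (mod int p)" by (rule cyclic_colouringD[OF f ab])
      ultimately have "[f a + int (p * k) = f a + 1] (mod int p)" by (metis cong_sym cong_trans)
      then have "[int p * int k = 1] (mod int p)" by (simp add: cong_add_lcancel)
      then have "int p dvd 1" by (metis cong_dvd_iff dvd_triv_left)
      then show False using p1 by simp
    qed
    ultimately have "card D < card F"
      using finite_unions[OF F(1)] by (simp add: psubset_card_mono psubsetI)
    then have powD: "\<exists>k. card S = p ^ k" if "S \<in> \<R>" "S \<subseteq> D" for S
      using less.hyps D that by blast
    have "R O D O R\<inverse> \<subseteq> D"
    proof (rule subrelI)
      fix a b assume "(a, b) \<in> R O D O R\<inverse>"
      then obtain x y where xy: "(a, x) \<in> R" "(x, y) \<in> D" "(b, y) \<in> R" by blast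
      then have V: "a \<in> V" "b \<in> V" "y \<in> V" using RV by auto
      obtain k where k: "(x, y) \<in> R ^^ (p * k)" using xy(2) by (auto simp: D_iff)
      \<comment> \<open>The last arc is traversed backwards along an \<open>R\<close>-walk from \<open>y\<close> to \<open>b\<close>, whose length is \<open>-1\<close> modulo \<open>p\<close> by the colouring.\<close>
      have "(b, y) \<in> R\<^sup>* \<inter> V \<times> V" using xy(3) V by auto
      then have "(y, b) \<in> R\<^sup>* \<inter> V \<times> V" using equiv_rtrancl[OF Run] by (meson equiv_def symD)
      then obtain l where l: "(y, b) \<in> R ^^ l" by (auto simp: rtrancl_is_UN_relpow)
      have "(b, b) \<in> R ^^ Suc l" using xy(3) l by (rule relpow_Suc_I2)
      then have "[f b = f b + int (Suc l)] (mod int p)" by (rule cyclic_colouring_relpow[OF f])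
      then have "[f b + int (Suc l) = f b] (mod int p)" by (rule cong_sym)
      then have "int p dvd int (Suc l)" by (simp only: cong_iff_dvd_diff add_diff_cancel_left')
      then have "p dvd Suc l" by (simp only: of_nat_dvd_iff)
      then obtain j where j: "Suc l = p * j" by (rule dvdE)
      have "(a, b) \<in> R ^^ (Suc (p * k) + l)"
        unfolding relpow_add using relpow_Suc_I2[OF xy(1) k] l by blast
      moreover have "Suc (p * k) + l = p * (k + j)" using j by (simp add: algebra_simps)
      ultimately show "(a, b) \<in> D" unfolding D_iff using V by metis
    qed
    then show ?thesis
      by (intro prime_power_of_normalized_closed[OF p association_scheme_axioms n D powD R(1)])
  qed
qed

end

section \<open>Cyclically partite basis digraphs\<close>

context association_scheme
begin

lemma Field_basis:
  assumes "R \<in> \<R>"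
  shows "Field R = V"
proof
  show "Field R \<subseteq> V" using basis_subset[OF assms] by (auto simp: Field_def)
  show "V \<subseteq> Field R"
    using successor_exists[OF basis_in_unions[OF assms] basis_nonempty[OF assms]]
    by (metis FieldI1 subsetI)
qed

lemma reflexive_basis_digraph_iff:
  assumes "R \<in> \<R>"
  shows "reflexive_digraph (support R, R) \<longleftrightarrow> R = Id_on V"
proof -
  obtain u where "u \<in> V" using points_nonempty by blast
  then show ?thesis
    using basis_fixed_point[OF assms, of u]
    by (auto simp: reflexive_digraph_def support_eq_Field Field_basis[OF assms])
qed

text \<open>A partition yields the colouring by the index of the part. Conversely the colour classes are nonempty because
  a walk along \<open>R\<close> can be continued forever and passes through all residues modulo \<open>p\<close>.\<close>

lemma cyclically_partite_iff_colouring: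
  assumes R: "R \<in> \<R>" and p: "p > 0"
  shows "cyclically_partite p (support R, R) \<longleftrightarrow> (\<exists>f. cyclic_colouring p f R)"
proof
  assume "cyclically_partite p (support R, R)"
  then obtain P where "(\<Union>i<p. P i) = V"
    and arcs: "\<forall>(u, v)\<in>R. \<forall>i<p. \<forall>j<p. u \<in> P i \<longrightarrow> v \<in> P j \<longrightarrow> [int j - int i = 1] (mod int p)"
    unfolding cyclically_partite_def fst_conv snd_conv support_eq_Field Field_basis[OF R] by blast
  moreover from arcs have "[int j - int i = 1] (mod int p)"
    if "(u, v) \<in> R" "i < p" "j < p" "u \<in> P i" "v \<in> P j" for u v i j
    using that by blast
  ultimately have P: "(\<Union>i<p. P i) = V"
    "\<And>u v i j. (u, v) \<in> R \<Longrightarrow> i < p \<Longrightarrow> j < p \<Longrightarrow> u \<in> P i \<Longrightarrow> v \<in> P j \<Longrightarrow> [int j - int i = 1] (mod int p)"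
    by blast+
  define c where "c u = (SOME i. i < p \<and> u \<in> P i)" for u
  have c: "c u < p \<and> u \<in> P (c u)" if "u \<in> V" for u
  proof -
    have "\<exists>i. i < p \<and> u \<in> P i" using P(1) that by auto
    then show ?thesis unfolding c_def by (rule someI_ex)
  qed
  have "[int (c v) = int (c u) + 1] (mod int p)" if uv: "(u, v) \<in> R" for u v
  proof -
    have "u \<in> V" "v \<in> V" using uv basis_subset[OF R] by auto
    then have "[int (c v) - int (c u) = 1] (mod int p)" using P(2)[OF uv] c by blast
    then show ?thesis by (simp add: cong_iff_dvd_diff algebra_simps)
  qed
  then have "cyclic_colouring p (\<lambda>u. int (c u)) R" by (auto simp: cyclic_colouring_def)
  then show "\<exists>f. cyclic_colouring p f R" by (rule exI[of _ "\<lambda>u. int (c u)"])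
next
  assume "\<exists>f. cyclic_colouring p f R"
  then obtain f where f: "cyclic_colouring p f R" ..
  define P where "P i = {u \<in> V. [f u = int i] (mod int p)}" for i
  have eq: "i = j" if "i < p" "j < p" "[int i = int j] (mod int p)" for i j
    using that cong_less_modulus_unique_nat cong_int_iff by blast
  have "u \<in> (\<Union>i<p. P i)" if "u \<in> V" for u
  proof -
    have "nat (f u mod int p) < p" "[f u = int (nat (f u mod int p))] (mod int p)"
      using p by (simp_all add: cong_def nat_less_iff)
    then show ?thesis
      using that by (intro UN_I[of "nat (f u mod int p)"]) (simp_all only: lessThan_iff P_def mem_Collect_eq simp_thms)
  qed
  then have cover: "(\<Union>i<p. P i) = V" by (auto simp: P_def)
  have walk: "\<exists>v\<in>V. (u, v) \<in> R ^^ n" if "u \<in> V" for u n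
  proof (induction n)
    case 0
    then show ?case using that by auto
  next
    case (Suc n)
    then obtain v where v: "v \<in> V" "(u, v) \<in> R ^^ n" by blast
    obtain w where w: "(v, w) \<in> R"
      using successor_exists[OF basis_in_unions[OF R] basis_nonempty[OF R] v(1)] by blast
    then have "w \<in> V" using basis_subset[OF R] by auto
    then show ?case using v w by auto
  qed
  have nonempty: "P i \<noteq> {}" if "i < p" for i
  proof -
    obtain u where u: "u \<in> V" using points_nonempty by blast
    define n where "n = nat ((int i - f u) mod int p)"
    have n: "[int n = int i - f u] (mod int p)" using p by (simp add: n_def cong_def)
    obtain v where v: "v \<in> V" "(u, v) \<in> R ^^ n" using walk[OF u] by blast
    have "[f v = f u + int n] (mod int p)" by (rule cyclic_colouring_relpow[OF f v(2)])
    also have "[f u + int n = f u + (int i - f u)] (mod int p)" using n by (simp only: cong_add_lcancel)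
    finally have "v \<in> P i" using v(1) by (simp add: P_def)
    then show ?thesis by blast
  qed
  have disj: "disjoint_family_on P {..<p}"
    unfolding disjoint_family_on_def
  proof (intro ballI impI equals0I)
    fix i j u assume ij: "i \<in> {..<p}" "j \<in> {..<p}" "i \<noteq> j" and "u \<in> P i \<inter> P j"
    then have "[int i = int j] (mod int p)" by (auto simp: P_def) (metis cong_sym cong_trans)
    then show False using eq ij by auto
  qed
  have arcs: "[int j - int i = 1] (mod int p)" if "(u, v) \<in> R" "u \<in> P i" "v \<in> P j" for u v i j
  proof -
    have "[int j - int i = f v - f u] (mod int p)"
      using that(2,3) by (intro cong_diff) (auto simp: P_def cong_sym)
    also have "[f v - f u = 1] (mod int p)"
      using cyclic_colouringD[OF f that(1)] by (simp add: cong_iff_dvd_diff algebra_simps)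
    finally show ?thesis .
  qed
  show "cyclically_partite p (support R, R)"
    unfolding cyclically_partite_def fst_conv snd_conv support_eq_Field Field_basis[OF R]
    using cover nonempty disj arcs by (intro exI[of _ P]) auto
qed

end

section \<open>The characterization\<close>

theorem theorem1p1:
  fixes p :: nat and V :: "'v set" and \<R> :: "'v rel set"
  assumes "prime p" and "association_scheme V \<R>"
  shows "p_scheme p V \<R> \<longleftrightarrow>
    (\<forall>G \<in> basis_digraphs \<R>. \<not> reflexive_digraph G \<longrightarrow> cyclically_partite p G)"
proof -
  interpret association_scheme V \<R> by (rule assms(2))
  have p: "p > 0" using prime_gt_0_nat[OF assms(1)] .
  have "(\<forall>G \<in> basis_digraphs \<R>. \<not> reflexive_digraph G \<longrightarrow> cyclically_partite p G) \<longleftrightarrow>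
      (\<forall>R\<in>\<R>. R \<noteq> Id_on V \<longrightarrow> (\<exists>f. cyclic_colouring p f R))"
    using reflexive_basis_digraph_iff cyclically_partite_iff_colouring[OF _ p]
    by (auto simp: basis_digraphs_def)
  also have "\<dots> \<longleftrightarrow> p_scheme p V \<R>"
  proof
    assume col: "\<forall>R\<in>\<R>. R \<noteq> Id_on V \<longrightarrow> (\<exists>f. cyclic_colouring p f R)"
    have all: "V \<times> V \<in> unions_of \<R>" "equiv V (V \<times> V)"
      using basis_subset by (auto intro!: unionsI equivI refl_onI symI transI)
    have "\<exists>k. card R = p ^ k" if "R \<in> \<R>" for R
      by (rule colourings_imp_prime_power[OF assms(1) _ all that]) (use col basis_subset[OF that] in auto)
    then show "p_scheme p V \<R>" using scheme_axioms by (simp add: p_scheme_def)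
  next
    assume "p_scheme p V \<R>"
    then show "\<forall>R\<in>\<R>. R \<noteq> Id_on V \<longrightarrow> (\<exists>f. cyclic_colouring p f R)"
      using p_scheme_colouring[OF assms] by (auto simp: p_scheme_def)
  qed
  finally show ?thesis by simp
qed

end
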